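(* In the setting of the context, let $\lambda_0,\lambda_1>0$. For every stopping rule $\psi\in\mathscr F_0$, $$L(\psi)\ge\bar c_1+\bar V_1(1).\qquad(1)$$ There is equality in (1) if $\psi\in\mathscr F_0$ satisfies the following condition $\mathfrak S_\infty(\psi)$: for all $1\le k<\infty$ and all $n\in\mathcal P_k$, $$\psi_n\simeq I_{\{g(z_n)\preccurlyeq\bar c_{k+1}+\bar V_{k+1}(z_n)\}}\quad P_0\text{-almost surely on }T_n^\psi.$$ Conversely, if there is equality in (1) for some $\psi\in\mathscr F_0$, then $\psi$ satisfies condition $\mathfrak S_\infty(\psi)$.
   Context: Setting. Observations arrive in groups $k=1,2,\dots$ of random sizes $\nu_1,\nu_2,\dots$, which are independent with values in $\mathscr G\subset\{0,1,2,\dots\}$ and known p.m.f.s $p_k(m)=P(\nu_k=m)$, $m\in\mathscr G$. For $n=(n_1,\dots,n_k)\in\mathscr G^k$ put $p(n)=\prod_{i=1}^kp_i(n_i)$, and $\mathcal P_k=\{n\in\mathscr G^k:p(n)>0\}$. Given the group sizes, all observations $X_{ij}$ ($j\le n_i$, $i\le k$) are i.i.d. with values in a measurable space $(\mathfrak X,\mathscr X)$ and density $f_\theta$ with respect to a $\sigma$-finite measure $\mu$, $\theta\in\{\theta_0,\theta_1\}$. Thus, given sizes $n$, the data $X^{(n)}=(X_1^{(n_1)},\dots,X_k^{(n_k)})$, $X_i^{(n_i)}=(X_{i1},\dots,X_{in_i})$, has density $f_\theta^{(n)}(x^{(n)})=\prod_{i=1}^k\prod_{j=1}^{n_i}f_\theta(x_{ij})$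 with respect to $\mu^n=\mu^{n_1}\otimes\cdots\otimes\mu^{n_k}$ on $\mathfrak X^n=\mathfrak X^{n_1}\times\cdots\times\mathfrak X^{n_k}$ (empty products are $1$; $\mathfrak X^0$ is a one-point space and $\mu^0$ a probability measure on it). For a function $F_n$ on $\mathfrak X^n$, $E_\theta F_n=\int F_nf_\theta^{(n)}d\mu^n$. Write $f_i,E_i,P_i$ for $f_{\theta_i},E_{\theta_i},P_{\theta_i}$, $i=0,1$. It is assumed that $\mu\{x:f_0(x)\ne f_1(x)\}>0$. A stopping rule $\psi$ is a family of measurable functions $\psi_n:\mathfrak X^n\to[0,1]$, $n\in\mathscr G^k$, $k\ge1$. For $n=(n_1,\dots,n_k)$ let $t_n^\psi(x^{(n)})=\prod_{i=1}^{k-1}\bigl(1-\psi_{(n_1,\dots,n_i)}(x_1^{(n_1)},\dots,x_i^{(n_i)})\bigr)$ (equal to $1$ for $k=1$), $s_n^\psi=t_n^\psi\psi_n$, $T_n^\psi=\{x^{(n)}\in\mathfrak X^n:t_n^\psi(x^{(n)})>0\}$. $\mathscr F_0$ is the set of stopping rules with $\sum_{k\ge1}\sum_{n\in\mathscr G^k}p(n)E_0s_n^\psi=1$. Costs: $c(m)>0$ for $m\in\mathscr G$; $c(n)=\sum_{i=1}^kc(n_i)$ for $n\in\mathscr G^k$; $\bar c_k=\sum_{m\in\mathscr G}p_k(m)c(m)$, assumed to satisfy $0<\bar c_k<\infty$ for all $k$. Likelihood ratio: $z_n=f_1^{(n)}(x^{(n)})/f_0^{(n)}(x^{(n)})$ if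 $f_0^{(n)}(x^{(n)})>0$, $z_n=\infty$ if $f_0^{(n)}(x^{(n)})=0<f_1^{(n)}(x^{(n)})$, and $z_n=0$ otherwise. Let $g(z)=\min\{\lambda_0,\lambda_1z\}$, $z\ge0$, and $L(\psi)=\sum_{k=1}^\infty\sum_{n\in\mathscr G^k}p(n)E_0s_n^\psi\bigl(c(n)+g(z_n)\bigr)\in[0,\infty]$. For $N\ge1$ define on $z\ge0$: $V_N^N(z)=g(z)$ and, for $k=N,N-1,\dots,2$, $V_{k-1}^N(z)=\min\{g(z),\ \bar c_k+\sum_{m\in\mathscr G}p_k(m)E_0V_k^N(zz_m)\}$; $\bar V_k^N(z)=\sum_{m\in\mathscr G}p_k(m)E_0V_k^N(zz_m)$, $1\le k\le N$ (here $z_m$ is the likelihood ratio of a single group of size $m$). For each fixed $k$ these are nonincreasing in $N$; $V_k(z)=\lim_{N\to\infty}V_k^N(z)$ and $\bar V_k(z)=\lim_{N\to\infty}\bar V_k^N(z)$. Notation: $\psi\simeq I_{\{F_1\preccurlyeq F_2\}}$ means $I_{\{F_1<F_2\}}\le\psi\le I_{\{F_1\le F_2\}}$. "$P_0$-almost surely on $T_n^\psi$" means for $\mu^n$-almost every $x^{(n)}\in T_n^\psi\cap\{f_0^{(n)}>0\}$. *)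

theory Defs
  imports "HOL-Probability.Probability"
begin

text \<open>
  Groups are numbered from 1, so \<open>p 0\<close> is never used.  A vector of group sizes
  \<open>(n\<^sub>1, \<dots>, n\<^sub>k)\<close> is a list of length \<open>k\<close>; since lists and products are indexed from 0,
  \<open>n ! i\<close> is the size of group \<open>Suc i\<close>, and \<open>x i j\<close> is observation \<open>Suc j\<close> of group \<open>Suc i\<close>.
\<close>

definition mean_cost :: "nat set \<Rightarrow> (nat \<Rightarrow> nat pmf) \<Rightarrow> (nat \<Rightarrow> real) \<Rightarrow> nat \<Rightarrow> ennreal" where
  "mean_cost G p c k = (\<Sum>\<^sub>\<infinity>m\<in>G. ennreal (pmf (p k) m * c m))"

locale grouped_observations = sigma_finite_measure \<mu>
  for \<mu> :: "'a measure" +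
  fixes f0 f1 :: "'a \<Rightarrow> real"
    and G :: "nat set"
    and p :: "nat \<Rightarrow> nat pmf"
    and c :: "nat \<Rightarrow> real"
  assumes f0_measurable: "f0 \<in> borel_measurable \<mu>"
    and f1_measurable: "f1 \<in> borel_measurable \<mu>"
    and f0_nonneg: "\<And>x. x \<in> space \<mu> \<Longrightarrow> 0 \<le> f0 x"
    and f1_nonneg: "\<And>x. x \<in> space \<mu> \<Longrightarrow> 0 \<le> f1 x"
    and f0_density: "(\<integral>\<^sup>+x. ennreal (f0 x) \<partial>\<mu>) = 1"
    and f1_density: "(\<integral>\<^sup>+x. ennreal (f1 x) \<partial>\<mu>) = 1"
    and f0_neq_f1: "0 < emeasure \<mu> {x \<in> space \<mu>. f0 x \<noteq> f1 x}"
    and sizes_in_G: "\<And>k. 1 \<le> k \<Longrightarrow> set_pmf (p k) \<subseteq> G"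
    and c_pos: "\<And>m. m \<in> G \<Longrightarrow> 0 < c m"
    and mean_cost_pos: "\<And>k. 1 \<le> k \<Longrightarrow> 0 < mean_cost G p c k"
    and mean_cost_finite: "\<And>k. 1 \<le> k \<Longrightarrow> mean_cost G p c k < \<infinity>"
begin

definition size_vectors :: "nat \<Rightarrow> nat list set" where
  "size_vectors k = {n. length n = k \<and> set n \<subseteq> G}"

definition size_prob :: "nat list \<Rightarrow> real" where
  "size_prob n = (\<Prod>i<length n. pmf (p (Suc i)) (n ! i))"

definition possible_sizes :: "nat \<Rightarrow> nat list set" where
  "possible_sizes k = {n \<in> size_vectors k. 0 < size_prob n}"

definition data_measure :: "nat list \<Rightarrow> (nat \<Rightarrow> nat \<Rightarrow> 'a) measure" where
  "data_measure n = (\<Pi>\<^sub>M i\<in>{..<length n}. \<Pi>\<^sub>M j\<in>{..<n ! i}. \<mu>)"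

definition joint_density :: "('a \<Rightarrow> real) \<Rightarrow> nat list \<Rightarrow> (nat \<Rightarrow> nat \<Rightarrow> 'a) \<Rightarrow> real" where
  "joint_density f n x = (\<Prod>i<length n. \<Prod>j<n ! i. f (x i j))"

definition E0 :: "nat list \<Rightarrow> ((nat \<Rightarrow> nat \<Rightarrow> 'a) \<Rightarrow> ennreal) \<Rightarrow> ennreal" where
  "E0 n F = (\<integral>\<^sup>+x. F x * ennreal (joint_density f0 n x) \<partial>data_measure n)"

definition lik_ratio :: "nat list \<Rightarrow> (nat \<Rightarrow> nat \<Rightarrow> 'a) \<Rightarrow> ennreal" where
  "lik_ratio n x =
     (if 0 < joint_density f0 n x then ennreal (joint_density f1 n x / joint_density f0 n x)
      else if 0 < joint_density f1 n x then \<infinity>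
      else 0)"

definition stopping_rule :: "(nat list \<Rightarrow> (nat \<Rightarrow> nat \<Rightarrow> 'a) \<Rightarrow> real) \<Rightarrow> bool" where
  "stopping_rule \<psi> \<longleftrightarrow> (\<forall>k\<ge>1. \<forall>n\<in>size_vectors k.
     \<psi> n \<in> borel_measurable (data_measure n) \<and>
     (\<forall>x\<in>space (data_measure n). 0 \<le> \<psi> n x \<and> \<psi> n x \<le> 1))"

definition t :: "(nat list \<Rightarrow> (nat \<Rightarrow> nat \<Rightarrow> 'a) \<Rightarrow> real) \<Rightarrow> nat list \<Rightarrow> (nat \<Rightarrow> nat \<Rightarrow> 'a) \<Rightarrow> real" where
  "t \<psi> n x = (\<Prod>i\<in>{1..<length n}. 1 - \<psi> (take i n) (restrict x {..<i}))"

definition s :: "(nat list \<Rightarrow> (nat \<Rightarrow> nat \<Rightarrow> 'a) \<Rightarrow> real) \<Rightarrow> nat list \<Rightarrow> (nat \<Rightarrow> nat \<Rightarrow> 'a) \<Rightarrow> real" where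
  "s \<psi> n x = t \<psi> n x * \<psi> n x"

definition T :: "(nat list \<Rightarrow> (nat \<Rightarrow> nat \<Rightarrow> 'a) \<Rightarrow> real) \<Rightarrow> nat list \<Rightarrow> (nat \<Rightarrow> nat \<Rightarrow> 'a) set" where
  "T \<psi> n = {x \<in> space (data_measure n). 0 < t \<psi> n x}"

definition F0 :: "(nat list \<Rightarrow> (nat \<Rightarrow> nat \<Rightarrow> 'a) \<Rightarrow> real) set" where
  "F0 = {\<psi>. stopping_rule \<psi> \<and>
     (\<Sum>k. \<Sum>\<^sub>\<infinity>n\<in>size_vectors (Suc k). ennreal (size_prob n) * E0 n (\<lambda>x. ennreal (s \<psi> n x))) = 1}"

definition cost :: "nat list \<Rightarrow> real" where
  "cost n = (\<Sum>i<length n. c (n ! i))"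

text \<open>
  \<open>g\<close> and the functions \<open>V\<close> are meant for finite \<open>z \<ge> 0\<close>.  They are defined on \<open>[0, \<infinity>]\<close> because
  the likelihood ratio can be infinite; it is so only where the density under \<open>f0\<close> vanishes,
  and there \<open>E0\<close> does not see the value.
\<close>

definition g :: "real \<Rightarrow> real \<Rightarrow> ennreal \<Rightarrow> ennreal" where
  "g l0 l1 z = min (ennreal l0) (ennreal l1 * z)"

definition L :: "real \<Rightarrow> real \<Rightarrow> (nat list \<Rightarrow> (nat \<Rightarrow> nat \<Rightarrow> 'a) \<Rightarrow> real) \<Rightarrow> ennreal" where
  "L l0 l1 \<psi> = (\<Sum>k. \<Sum>\<^sub>\<infinity>n\<in>size_vectors (Suc k). ennreal (size_prob n) *
     E0 n (\<lambda>x. ennreal (s \<psi> n x) * (ennreal (cost n) + g l0 l1 (lik_ratio n x))))"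

definition group_mean :: "nat \<Rightarrow> (ennreal \<Rightarrow> ennreal) \<Rightarrow> ennreal \<Rightarrow> ennreal" where
  "group_mean k W z =
     (\<Sum>\<^sub>\<infinity>m\<in>G. ennreal (pmf (p k) m) * E0 [m] (\<lambda>x. W (z * lik_ratio [m] x)))"

text \<open>
  \<open>VN l0 l1 N k\<close> is the function \<open>V\<^sub>k\<close> of the problem truncated at \<open>N\<close>.  Only \<open>k \<le> N\<close> is meaningful;
  for fixed \<open>k\<close> the other \<open>N\<close> are finitely many and do not affect the limit in \<open>V_bar\<close>, which
  exists because \<open>VN_bar l0 l1 N k z\<close> is nonincreasing in \<open>N \<ge> k\<close>.
\<close>

function VN :: "real \<Rightarrow> real \<Rightarrow> nat \<Rightarrow> nat \<Rightarrow> ennreal \<Rightarrow> ennreal" where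
  "VN l0 l1 N k =
     (if k < N
      then (\<lambda>z. min (g l0 l1 z) (mean_cost G p c (Suc k) + group_mean (Suc k) (VN l0 l1 N (Suc k)) z))
      else g l0 l1)"
  by pat_completeness auto
termination
  by (relation "Wellfounded.measure (\<lambda>(l0, l1, N, k). N - k)") auto

declare VN.simps [simp del]

definition VN_bar :: "real \<Rightarrow> real \<Rightarrow> nat \<Rightarrow> nat \<Rightarrow> ennreal \<Rightarrow> ennreal" where
  "VN_bar l0 l1 N k z = group_mean k (VN l0 l1 N k) z"

definition V_bar :: "real \<Rightarrow> real \<Rightarrow> nat \<Rightarrow> ennreal \<Rightarrow> ennreal" where
  "V_bar l0 l1 k z = lim (\<lambda>N. VN_bar l0 l1 N k z)"

definition between_indicators :: "real \<Rightarrow> ennreal \<Rightarrow> ennreal \<Rightarrow> bool" where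
  "between_indicators u a b \<longleftrightarrow> of_bool (a < b) \<le> u \<and> u \<le> of_bool (a \<le> b)"

definition S_infty :: "real \<Rightarrow> real \<Rightarrow> (nat list \<Rightarrow> (nat \<Rightarrow> nat \<Rightarrow> 'a) \<Rightarrow> real) \<Rightarrow> bool" where
  "S_infty l0 l1 \<psi> \<longleftrightarrow> (\<forall>k\<ge>1. \<forall>n\<in>possible_sizes k.
     AE x in data_measure n. x \<in> T \<psi> n \<and> 0 < joint_density f0 n x \<longrightarrow>
       between_indicators (\<psi> n x) (g l0 l1 (lik_ratio n x))
         (mean_cost G p c (Suc k) + V_bar l0 l1 (Suc k) (lik_ratio n x)))"

end

end

theory Submission imports Defs begin

text \<open>
  The limit function satisfies the Bellman equation
  \<open>V\<^sub>k z = min (g z) (c\<^sub>k\<^sub>+\<^sub>1 + \<integral>V\<^sub>k\<^sub>+\<^sub>1)\<close>, by monotone convergence in the truncation level.  For a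
  stopping rule \<open>\<psi>\<close> let \<open>A\<^sub>k\<close> be the cost of the stops before stage \<open>k\<close> plus the mean of
  \<open>t (c(n) + V\<^sub>k(z))\<close> over the runs that reach stage \<open>k\<close>.  Then \<open>A\<^sub>1\<close> is the lower bound, and
  \<open>A\<^sub>k\<^sub>+\<^sub>1 - A\<^sub>k\<close> is the mean of \<open>t\<close> times the amount by which a mixture of the two terms of the
  Bellman minimum, with weights \<open>\<psi>\<close> and \<open>1 - \<psi>\<close>, exceeds that minimum.  This gap is nonnegative,
  and it vanishes exactly when \<open>\<psi>\<close> almost surely puts no weight on the strictly larger term.  If \<open>\<psi>\<close>
  stops with probability one, the part of \<open>A\<^sub>k\<close> due to unfinished runs exceeds the later stopping
  costs by at most \<open>\<lambda>\<^sub>0\<close> times the probability of not having stopped, so \<open>L(\<psi>)\<close> bounds every \<open>A\<^sub>k\<close>.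
\<close>

section \<open>Integration over groups\<close>

text \<open>The infinite sum is a supremum over finite subsets, and each finite sum is the integral
  of \<open>f\<close> cut off to that subset. Conversely, the initial segments \<open>B i\<close> of
  an enumeration exhaust \<open>A\<close>, and monotone convergence applies. This makes Tonelli and
  monotone convergence available for sums over group sizes.\<close>

lemma infsum_eq_nn_integral_count_space:
  fixes f :: "'b \<Rightarrow> ennreal"
  assumes "countable A"
  shows "infsum f A = (\<integral>\<^sup>+a. f a \<partial>count_space A)"
proof (rule antisym)
  have *: "sum f F = (\<integral>\<^sup>+a. f a * indicator F a \<partial>count_space A)" if "finite F" "F \<subseteq> A" for F
  proof -
    have "(\<integral>\<^sup>+a. f a * indicator F a \<partial>count_space A) = (\<Sum>a\<in>F. f a * indicator F a)"
      by (rule nn_integral_count_space') (use that in \<open>auto simp: indicator_def\<close>)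
    then show ?thesis by (simp add: indicator_def)
  qed
  have infsum: "infsum f A = (SUP F\<in>{F. finite F \<and> F \<subseteq> A}. sum f F)"
    by (rule nonneg_infsum_complete) auto
  show "infsum f A \<le> (\<integral>\<^sup>+a. f a \<partial>count_space A)"
    unfolding infsum
    by (rule SUP_least) (auto simp: * indicator_def intro!: nn_integral_mono)
  define B where "B i = {a \<in> A. to_nat_on A a < i}" for i
  have fin: "finite (B i)" "B i \<subseteq> A" for i
  proof -
    have "inj_on (to_nat_on A) (B i)"
      using inj_on_to_nat_on[OF assms] by (rule inj_on_subset) (auto simp: B_def)
    then show "finite (B i)"
      by (rule inj_on_finite[of _ _ "{..<i}"]) (auto simp: B_def)
  qed (auto simp: B_def)
  have "f a = (SUP i. f a * indicator (B i) a)" if "a \<in> A" for a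
  proof (rule antisym)
    have "f a = f a * indicator (B (Suc (to_nat_on A a))) a"
      using that by (simp add: B_def)
    also have "\<dots> \<le> (SUP i. f a * indicator (B i) a)"
      by (rule SUP_upper) simp
    finally show "f a \<le> (SUP i. f a * indicator (B i) a)" .
  qed (auto intro!: SUP_least simp: indicator_def)
  then have "(\<integral>\<^sup>+a. f a \<partial>count_space A) = (\<integral>\<^sup>+a. (SUP i. f a * indicator (B i) a) \<partial>count_space A)"
    by (intro nn_integral_cong) simp
  also have "\<dots> = (SUP i. \<integral>\<^sup>+a. f a * indicator (B i) a \<partial>count_space A)"
    by (rule nn_integral_monotone_convergence_SUP)
      (auto simp: incseq_def le_fun_def B_def indicator_def)
  also have "\<dots> \<le> infsum f A"
    unfolding infsum using fin by (intro SUP_least) (auto simp flip: * intro!: SUP_upper)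
  finally show "(\<integral>\<^sup>+a. f a \<partial>count_space A) \<le> infsum f A" .
qed

text \<open>Multiplication by a finite constant is continuous on the extended half-line, so it
  commutes with the limit of a decreasing sequence.\<close>

lemma INF_cmult_ennreal:
  fixes f :: "nat \<Rightarrow> ennreal"
  assumes "decseq f"
  shows "(INF i. ennreal r * f i) = ennreal r * (INF i. f i)"
proof (rule LIMSEQ_unique)
  have "decseq (\<lambda>i. ennreal r * f i)"
    using assms by (auto simp: decseq_def intro!: mult_left_mono)
  then show "(\<lambda>i. ennreal r * f i) \<longlonglongrightarrow> (INF i. ennreal r * f i)"
    by (rule LIMSEQ_INF)
  show "(\<lambda>i. ennreal r * f i) \<longlonglongrightarrow> ennreal r * (INF i. f i)"
    by (intro ennreal_tendsto_cmult LIMSEQ_INF assms) simp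
qed

context grouped_observations
begin

section \<open>Product measures, joint densities and expectations under \<open>f0\<close>\<close>

abbreviation block :: "nat list \<Rightarrow> nat \<Rightarrow> (nat \<Rightarrow> 'a) measure" where
  "block n i \<equiv> \<Pi>\<^sub>M j\<in>{..<n ! i}. \<mu>"

lemma product_sigma_finite_const: "product_sigma_finite (\<lambda>_::nat. \<mu>)"
  by (simp add: product_sigma_finite_def sigma_finite_measure_axioms)

lemma product_sigma_finite_block: "product_sigma_finite (block n)"
  by (simp add: product_sigma_finite_def
      product_sigma_finite.sigma_finite[OF product_sigma_finite_const])

lemma sigma_finite_data_measure: "sigma_finite_measure (data_measure n)"
  unfolding data_measure_def
  by (simp add: product_sigma_finite.sigma_finite[OF product_sigma_finite_block])

text \<open>Index sets of the form \<open>insert i I\<close> are what the insertion rule for product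
  integrals needs in order to split off the newest group.\<close>

lemma data_measure_snoc:
  "data_measure (n @ [m]) = (\<Pi>\<^sub>M i\<in>insert (length n) {..<length n}. block (n @ [m]) i)"
  unfolding data_measure_def by (simp add: lessThan_Suc)

text \<open>The insertion rule works with one family of factors, so the earlier groups must be
  described by \<open>block (n @ [m])\<close> too.\<close>

lemma data_measure_eq_block_snoc:
  "data_measure n = (\<Pi>\<^sub>M i\<in>{..<length n}. block (n @ [m]) i)"
  unfolding data_measure_def by (intro PiM_cong) (auto simp: nth_append)

lemma data_measure_single: "data_measure [m] = (\<Pi>\<^sub>M i\<in>{0}. block [m] i)"
  unfolding data_measure_def by (simp add: lessThan_Suc)

lemma measurable_observation:
  assumes "i < length n" "j < n ! i" "f \<in> borel_measurable \<mu>"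
  shows "(\<lambda>x. f (x i j)) \<in> borel_measurable (data_measure n)"
proof -
  have "(\<lambda>x. x i) \<in> measurable (data_measure n) (block n i)"
    unfolding data_measure_def using assms by (intro measurable_component_singleton) auto
  moreover have "(\<lambda>y. y j) \<in> measurable (block n i) \<mu>"
    using assms by (intro measurable_component_singleton) auto
  ultimately show ?thesis
    using measurable_compose[OF measurable_compose[OF _ _] assms(3)] by blast
qed

lemma measurable_joint_density [measurable]:
  assumes "f \<in> borel_measurable \<mu>"
  shows "joint_density f n \<in> borel_measurable (data_measure n)"
  unfolding joint_density_def
  by (intro borel_measurable_prod measurable_observation assms) auto

lemma space_observation:
  assumes "x \<in> space (data_measure n)" "i < length n" "j < n ! i"
  shows "x i j \<in> space \<mu>"
proof -
  have "x i \<in> space (block n i)"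
    using assms by (auto simp: data_measure_def space_PiM PiE_iff)
  then show ?thesis using assms by (auto simp: space_PiM PiE_iff)
qed

lemma joint_density_nonneg:
  assumes "x \<in> space (data_measure n)"
  shows "0 \<le> joint_density f0 n x" "0 \<le> joint_density f1 n x"
  unfolding joint_density_def
  by (auto intro!: prod_nonneg f0_nonneg f1_nonneg space_observation[OF assms])

lemma joint_density_snoc:
  "joint_density f (n @ [m]) (x(length n := y 0)) = joint_density f n x * joint_density f [m] y"
  by (simp add: joint_density_def lessThan_Suc nth_append)

lemma measurable_lik_ratio [measurable]:
  "lik_ratio n \<in> borel_measurable (data_measure n)"
  using measurable_joint_density[OF f0_measurable, measurable]
    measurable_joint_density[OF f1_measurable, measurable]
  unfolding lik_ratio_def[abs_def] by measurable

lemma measurable_update_group: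
  "(\<lambda>(x, y). x(length n := y 0)) \<in>
     measurable (data_measure n \<Otimes>\<^sub>M data_measure [m]) (data_measure (n @ [m]))"
proof -
  have [measurable]: "(\<lambda>y. y 0) \<in> measurable (data_measure [m]) (block (n @ [m]) (length n))"
    unfolding data_measure_def
    by (rule measurable_compose[OF measurable_component_singleton[where i=0]]) auto
  have "(\<lambda>z. (fst z)(length n := snd z 0)) \<in>
     measurable (data_measure n \<Otimes>\<^sub>M data_measure [m]) (data_measure (n @ [m]))"
    unfolding data_measure_snoc
  proof (rule measurable_fun_upd)
    show "insert (length n) {..<length n} = {..<length n} \<union> {length n}" by auto
    show "fst \<in> measurable (data_measure n \<Otimes>\<^sub>M data_measure [m]) (\<Pi>\<^sub>M i\<in>{..<length n}. block (n @ [m]) i)"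
      unfolding data_measure_eq_block_snoc[of n m, symmetric] by measurable
  qed measurable
  then show ?thesis by (simp add: case_prod_beta')
qed

lemma measurable_update_group_right:
  assumes "x \<in> space (data_measure n)"
  shows "(\<lambda>y. x(length n := y 0)) \<in> measurable (data_measure [m]) (data_measure (n @ [m]))"
  using measurable_compose[OF measurable_Pair1'[OF assms] measurable_update_group] by simp

text \<open>Tonelli in the last group, together with the factorization of the joint density. The new
  group is sampled as a one-group experiment \<open>y\<close>, whose only group has index 0; this is
  why \<open>y 0\<close> is inserted.\<close>

lemma E0_snoc:
  assumes [measurable]: "F \<in> borel_measurable (data_measure (n @ [m]))"
  shows "E0 (n @ [m]) F = E0 n (\<lambda>x. E0 [m] (\<lambda>y. F (x(length n := y 0))))"
proof -
  interpret B: product_sigma_finite "block (n @ [m])" by (rule product_sigma_finite_block)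
  interpret S: product_sigma_finite "block [m]" by (rule product_sigma_finite_block)
  note density = measurable_joint_density[OF f0_measurable, measurable]
  have block: "block [m] 0 = block (n @ [m]) (length n)" by simp
  have "E0 (n @ [m]) F = (\<integral>\<^sup>+x. \<integral>\<^sup>+y. F (x(length n := y)) *
      ennreal (joint_density f0 (n @ [m]) (x(length n := y)))
      \<partial>block (n @ [m]) (length n) \<partial>(\<Pi>\<^sub>M i\<in>{..<length n}. block (n @ [m]) i))"
    unfolding E0_def data_measure_snoc
    by (rule B.product_nn_integral_insert) (auto simp flip: data_measure_snoc)
  also have "\<dots> = (\<integral>\<^sup>+x. \<integral>\<^sup>+y. F (x(length n := y)) *
      ennreal (joint_density f0 (n @ [m]) (x(length n := y))) \<partial>block [m] 0 \<partial>data_measure n)"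
    by (simp add: data_measure_eq_block_snoc[of n m])
  also have "\<dots> = E0 n (\<lambda>x. E0 [m] (\<lambda>y. F (x(length n := y 0))))"
    unfolding E0_def
  proof (rule nn_integral_cong)
    fix x assume x: "x \<in> space (data_measure n)"
    note upd = measurable_update_group_right[OF x]
    have upd': "(\<lambda>y. x(length n := y)) \<in> measurable (block [m] 0) (data_measure (n @ [m]))"
      unfolding data_measure_snoc block using x
      by (intro measurable_component_update) (auto simp: data_measure_eq_block_snoc[of n m])
    have "(\<integral>\<^sup>+y. F (x(length n := y)) *
        ennreal (joint_density f0 (n @ [m]) (x(length n := y))) \<partial>block [m] 0)
      = (\<integral>\<^sup>+y. F (x(length n := y 0)) *
        ennreal (joint_density f0 (n @ [m]) (x(length n := y 0))) \<partial>data_measure [m])"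
      \<comment> \<open>The insertion rule leaves an integral over a bare block; a product over the
        single index 0 turns it into an integral over \<open>data_measure [m]\<close>.\<close>
      unfolding data_measure_single
      by (intro S.product_nn_integral_singleton[symmetric] borel_measurable_times_ennreal
          measurable_compose[OF upd' assms] measurable_compose[OF upd']
          measurable_compose[OF density measurable_ennreal])
    also have "\<dots> = (\<integral>\<^sup>+y. F (x(length n := y 0)) * ennreal (joint_density f0 [m] y) *
        ennreal (joint_density f0 n x) \<partial>data_measure [m])"
      using x joint_density_nonneg(1)
      by (intro nn_integral_cong) (simp add: joint_density_snoc ennreal_mult mult_ac)
    also have "\<dots> = (\<integral>\<^sup>+y. F (x(length n := y 0)) * ennreal (joint_density f0 [m] y) \<partial>data_measure [m]) *
        ennreal (joint_density f0 n x)"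
      by (intro nn_integral_multc borel_measurable_times_ennreal measurable_compose[OF upd assms]
          measurable_compose[OF density measurable_ennreal])
    finally show "(\<integral>\<^sup>+y. F (x(length n := y)) *
        ennreal (joint_density f0 (n @ [m]) (x(length n := y))) \<partial>block [m] 0) = \<dots>" .
  qed
  finally show ?thesis .
qed

text \<open>The joint density integrates to 1: the integral factors first over groups and then over
  observations into integrals of \<open>f0\<close>. An empty group contributes an empty
  product.\<close>

lemma E0_const: "E0 n (\<lambda>_. a) = a"
proof -
  interpret B: product_sigma_finite "block n" by (rule product_sigma_finite_block)
  interpret C: product_sigma_finite "\<lambda>_::nat. \<mu>" by (rule product_sigma_finite_const)
  note f0_measurable[measurable]
  have prods: "ennreal (joint_density f0 n x) = (\<Prod>i<length n. \<Prod>j<n ! i. ennreal (f0 (x i j)))"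
    if "x \<in> space (data_measure n)" for x
  proof -
    have nonneg: "0 \<le> f0 (x i j)" if "i < length n" "j < n ! i" for i j
      using f0_nonneg space_observation \<open>x \<in> space (data_measure n)\<close> that by blast
    then have "ennreal (joint_density f0 n x) = (\<Prod>i<length n. ennreal (\<Prod>j<n ! i. f0 (x i j)))"
      unfolding joint_density_def by (intro prod_ennreal[symmetric] prod_nonneg) auto
    also have "\<dots> = (\<Prod>i<length n. \<Prod>j<n ! i. ennreal (f0 (x i j)))"
      using nonneg by (intro prod.cong refl prod_ennreal[symmetric]) auto
    finally show ?thesis .
  qed
  have "(\<integral>\<^sup>+x. ennreal (joint_density f0 n x) \<partial>data_measure n)
    = (\<integral>\<^sup>+x. (\<Prod>i<length n. \<Prod>j<n ! i. ennreal (f0 (x i j))) \<partial>data_measure n)"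
    by (intro nn_integral_cong prods)
  also have "\<dots> = (\<Prod>i<length n. \<integral>\<^sup>+y. (\<Prod>j<n ! i. ennreal (f0 (y j))) \<partial>block n i)"
    unfolding data_measure_def by (rule B.product_nn_integral_prod) auto
  also have "\<dots> = 1"
    using C.product_nn_integral_prod[where f="\<lambda>_ y. ennreal (f0 y)"] by (simp add: f0_density)
  finally have "(\<integral>\<^sup>+x. ennreal (joint_density f0 n x) \<partial>data_measure n) = 1" .
  then show ?thesis
    using measurable_joint_density[OF f0_measurable] by (simp add: E0_def nn_integral_cmult)
qed

text \<open>Points where the density under \<open>f0\<close> vanishes have weight 0, so the
  comparison may assume positivity. Later pointwise arguments therefore meet only finite likelihood
  ratios.\<close>

lemma E0_mono:
  assumes "\<And>x. x \<in> space (data_measure n) \<Longrightarrow> 0 < joint_density f0 n x \<Longrightarrow> F x \<le> H x"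
  shows "E0 n F \<le> E0 n H"
  unfolding E0_def
proof (rule nn_integral_mono)
  fix x assume "x \<in> space (data_measure n)"
  then show "F x * ennreal (joint_density f0 n x) \<le> H x * ennreal (joint_density f0 n x)"
    using assms[of x] joint_density_nonneg(1)[of x n]
    by (cases "joint_density f0 n x = 0") (auto intro!: mult_right_mono)
qed

lemma E0_cong:
  assumes "\<And>x. x \<in> space (data_measure n) \<Longrightarrow> 0 < joint_density f0 n x \<Longrightarrow> F x = H x"
  shows "E0 n F = E0 n H"
  by (rule antisym; rule E0_mono) (simp_all add: assms)

lemma E0_add:
  assumes [measurable]: "F \<in> borel_measurable (data_measure n)" "H \<in> borel_measurable (data_measure n)"
  shows "E0 n (\<lambda>x. F x + H x) = E0 n F + E0 n H"
  using measurable_joint_density[OF f0_measurable, of n, measurable]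
  unfolding E0_def by (simp add: distrib_right nn_integral_add)

lemma E0_cmult:
  assumes [measurable]: "F \<in> borel_measurable (data_measure n)"
  shows "E0 n (\<lambda>x. a * F x) = a * E0 n F"
  using measurable_joint_density[OF f0_measurable, of n, measurable]
  unfolding E0_def by (simp add: mult.assoc nn_integral_cmult)

lemma E0_eq_0_iff:
  assumes [measurable]: "F \<in> borel_measurable (data_measure n)"
  shows "E0 n F = 0 \<longleftrightarrow> (AE x in data_measure n. 0 < joint_density f0 n x \<longrightarrow> F x = 0)"
proof -
  note measurable_joint_density[OF f0_measurable, of n, measurable]
  have "E0 n F = 0 \<longleftrightarrow> (AE x in data_measure n. F x * ennreal (joint_density f0 n x) = 0)"
    unfolding E0_def by (rule nn_integral_0_iff_AE) measurable
  also have "\<dots> \<longleftrightarrow> (AE x in data_measure n. 0 < joint_density f0 n x \<longrightarrow> F x = 0)"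
    by (intro AE_cong) (auto simp: ennreal_eq_0_iff)
  finally show ?thesis .
qed

lemma E0_count_space:
  assumes "countable A"
    and [measurable]: "\<And>a. a \<in> A \<Longrightarrow> F a \<in> borel_measurable (data_measure n)"
  shows "E0 n (\<lambda>x. \<integral>\<^sup>+a. F a x \<partial>count_space A) = (\<integral>\<^sup>+a. E0 n (F a) \<partial>count_space A)"
proof -
  note measurable_joint_density[OF f0_measurable, of n, measurable]
  have "E0 n (\<lambda>x. \<integral>\<^sup>+a. F a x \<partial>count_space A)
    = (\<integral>\<^sup>+x. \<integral>\<^sup>+a. F a x * ennreal (joint_density f0 n x) \<partial>count_space A \<partial>data_measure n)"
    unfolding E0_def by (simp add: nn_integral_multc)
  also have "\<dots> = (\<integral>\<^sup>+a. E0 n (F a) \<partial>count_space A)"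
    unfolding E0_def by (rule nn_integral_count_space_nn_integral) (use assms in auto)
  finally show ?thesis .
qed

lemma measurable_E0_snoc:
  assumes [measurable]: "F \<in> borel_measurable (data_measure (n @ [m]))"
  shows "(\<lambda>x. E0 [m] (\<lambda>y. F (x(length n := y 0)))) \<in> borel_measurable (data_measure n)"
proof -
  interpret S: sigma_finite_measure "data_measure [m]" by (rule sigma_finite_data_measure)
  note density = measurable_joint_density[OF f0_measurable, of "[m]"]
  have "(\<lambda>(x, y). F (x(length n := y 0)) * ennreal (joint_density f0 [m] y))
      \<in> borel_measurable (data_measure n \<Otimes>\<^sub>M data_measure [m])"
    using borel_measurable_times_ennreal[OF measurable_compose[OF measurable_update_group assms]
      measurable_compose[OF measurable_snd measurable_compose[OF density measurable_ennreal]]]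
    by (simp add: case_prod_beta')
  then show ?thesis unfolding E0_def by (rule S.borel_measurable_nn_integral)
qed

section \<open>Averaging over one further group\<close>

lemma group_mean_eq:
  "group_mean k W z =
     (\<integral>\<^sup>+m. ennreal (pmf (p k) m) * E0 [m] (\<lambda>x. W (z * lik_ratio [m] x)) \<partial>count_space G)"
  unfolding group_mean_def by (simp add: infsum_eq_nn_integral_count_space)

lemma size_probability:
  assumes "1 \<le> k"
  shows "(\<integral>\<^sup>+m. ennreal (pmf (p k) m) \<partial>count_space G) = 1"
  using sizes_in_G[OF assms] by (simp add: nn_integral_pmf measure_pmf.emeasure_eq_1_AE AE_measure_pmf_iff subset_iff)

lemma group_mean_const:
  assumes "1 \<le> k"
  shows "group_mean k (\<lambda>_. a) z = a"
  by (simp add: group_mean_eq E0_const nn_integral_multc size_probability[OF assms])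

lemma group_mean_mono:
  assumes "\<And>z. W z \<le> W' z"
  shows "group_mean k W z \<le> group_mean k W' z"
  unfolding group_mean_eq
  by (intro nn_integral_mono mult_left_mono E0_mono assms) auto

text \<open>For a fixed size, the integrand is jointly measurable in the starting ratio and the
  data, and a partial integral stays measurable. The sum over sizes is one more partial integral,
  against counting measure on the countable set \<open>G\<close>.\<close>

lemma measurable_group_mean [measurable]:
  assumes [measurable]: "W \<in> borel_measurable borel"
  shows "group_mean k W \<in> borel_measurable borel"
proof -
  have E: "(\<lambda>z. E0 [m] (\<lambda>x. W (z * lik_ratio [m] x))) \<in> borel_measurable borel" for m
  proof -
    interpret S: sigma_finite_measure "data_measure [m]" by (rule sigma_finite_data_measure)
    note measurable_joint_density[OF f0_measurable, of "[m]", measurable]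
    have "(\<lambda>(z, x). W (z * lik_ratio [m] x) * ennreal (joint_density f0 [m] x))
      \<in> borel_measurable (borel \<Otimes>\<^sub>M data_measure [m])"
      by measurable
    then show ?thesis unfolding E0_def by (rule S.borel_measurable_nn_integral)
  qed
  interpret C: sigma_finite_measure "count_space G"
    by (rule sigma_finite_measure_count_space_countable) simp
  have "(\<lambda>(m, z). ennreal (pmf (p k) m) * E0 [m] (\<lambda>x. W (z * lik_ratio [m] x)))
      \<in> borel_measurable (count_space G \<Otimes>\<^sub>M borel)"
    using E by (intro measurable_pair_measure_countable1) auto
  from measurable_pair_swap[OF this]
  have "(\<lambda>(z, m). ennreal (pmf (p k) m) * E0 [m] (\<lambda>x. W (z * lik_ratio [m] x)))
      \<in> borel_measurable (borel \<Otimes>\<^sub>M count_space G)"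
    by (simp add: case_prod_beta')
  then show ?thesis
    unfolding group_mean_eq[abs_def] by (rule C.borel_measurable_nn_integral)
qed

text \<open>Decreasing monotone convergence, used first for the data of a group and then for its
  size. It requires a finite integral of the first function, which the bound \<open>b\<close>
  provides at both levels.\<close>

lemma group_mean_INF:
  assumes "decseq W" and meas: "\<And>i. W i \<in> borel_measurable borel"
    and bound: "\<And>z. W 0 z \<le> ennreal b" and "1 \<le> k"
  shows "group_mean k (\<lambda>z. INF i. W i z) z = (INF i. group_mean k (W i) z)"
proof -
  note meas[measurable]
  have dec: "W j z \<le> W i z" if "i \<le> j" for i j z
    using decseqD[OF \<open>decseq W\<close> that] by (rule le_funD)
  have bound': "W i z \<le> ennreal b" for i z
    using dec[of 0 i z] bound[of z] by auto
  have fin: "E0 [m] (\<lambda>x. W i (z * lik_ratio [m] x)) \<le> ennreal b" for i m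
    using E0_mono[of "[m]" "\<lambda>x. W i (z * lik_ratio [m] x)" "\<lambda>_. ennreal b"] bound'
    by (simp add: E0_const)
  have E: "E0 [m] (\<lambda>x. INF i. W i (z * lik_ratio [m] x)) = (INF i. E0 [m] (\<lambda>x. W i (z * lik_ratio [m] x)))" for m
  proof -
    note measurable_joint_density[OF f0_measurable, of "[m]", measurable]
    have "E0 [m] (\<lambda>x. INF i. W i (z * lik_ratio [m] x)) =
      (\<integral>\<^sup>+x. (INF i. W i (z * lik_ratio [m] x) * ennreal (joint_density f0 [m] x)) \<partial>data_measure [m])"
      using dec unfolding E0_def
      by (intro nn_integral_cong)
        (simp add: decseq_def mult.commute[of _ "ennreal (joint_density _ _ _)"] flip: INF_cmult_ennreal)
    also have "\<dots> = (INF i. E0 [m] (\<lambda>x. W i (z * lik_ratio [m] x)))"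
      unfolding E0_def
    proof (rule nn_integral_monotone_convergence_INF_decseq)
      show "decseq (\<lambda>i x. W i (z * lik_ratio [m] x) * ennreal (joint_density f0 [m] x))"
        by (intro decseq_SucI le_funI mult_right_mono dec) auto
      show "(\<integral>\<^sup>+x. W 0 (z * lik_ratio [m] x) * ennreal (joint_density f0 [m] x) \<partial>data_measure [m]) < \<infinity>"
        using fin[where i=0 and m=m] unfolding E0_def by (auto intro: le_less_trans)
    qed measurable
    finally show ?thesis .
  qed
  have "group_mean k (\<lambda>z. INF i. W i z) z =
    (\<integral>\<^sup>+m. (INF i. ennreal (pmf (p k) m) * E0 [m] (\<lambda>x. W i (z * lik_ratio [m] x))) \<partial>count_space G)"
    unfolding group_mean_eq E using dec
    by (intro nn_integral_cong INF_cmult_ennreal[symmetric]) (auto simp: decseq_def intro!: E0_mono)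
  also have "\<dots> = (INF i. group_mean k (W i) z)"
    unfolding group_mean_eq
  proof (rule nn_integral_monotone_convergence_INF_decseq)
    show "decseq (\<lambda>i m. ennreal (pmf (p k) m) * E0 [m] (\<lambda>x. W i (z * lik_ratio [m] x)))"
      by (intro decseq_SucI le_funI mult_left_mono E0_mono dec) auto
    have "group_mean k (W 0) z \<le> ennreal b"
      using group_mean_mono[of "W 0" "\<lambda>_. ennreal b", OF bound] group_mean_const[OF \<open>1 \<le> k\<close>] by metis
    then show "(\<integral>\<^sup>+m. ennreal (pmf (p k) m) * E0 [m] (\<lambda>x. W 0 (z * lik_ratio [m] x)) \<partial>count_space G) < \<infinity>"
      unfolding group_mean_eq by (auto intro: le_less_trans)
  qed simp
  finally show ?thesis .
qed

section \<open>The Bellman equation\<close>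

lemma measurable_g [measurable]: "g l0 l1 \<in> borel_measurable borel"
  unfolding g_def[abs_def] by measurable

lemma g_le: "g l0 l1 z \<le> ennreal l0"
  by (simp add: g_def)

text \<open>With the horizon written as \<open>k + d\<close>, the number \<open>d\<close> of
  remaining stages becomes the induction variable; the \<open>+ 0\<close> keeps that shape in the
  base case.\<close>

lemma VN_0: "VN l0 l1 (k + 0) k = g l0 l1"
  by (simp add: VN.simps)

lemma VN_Suc:
  "VN l0 l1 (k + Suc d) k =
     (\<lambda>z. min (g l0 l1 z) (mean_cost G p c (Suc k) + group_mean (Suc k) (VN l0 l1 (Suc k + d) (Suc k)) z))"
  by (subst VN.simps) simp

lemma measurable_VN [measurable]: "VN l0 l1 (k + d) k \<in> borel_measurable borel"
proof (induction d arbitrary: k)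
  case 0
  show ?case unfolding VN_0 by measurable
next
  case (Suc d)
  note Suc.IH[of "Suc k", measurable]
  show ?case unfolding VN_Suc by measurable
qed

text \<open>At the old horizon a further stage replaces \<open>g\<close> by a minimum that includes
  \<open>g\<close>. Monotonicity of the group mean carries this decrease back to all earlier
  stages.\<close>

lemma VN_decseq: "decseq (\<lambda>d. VN l0 l1 (k + d) k)"
proof -
  have "VN l0 l1 (k + Suc d) k z \<le> VN l0 l1 (k + d) k z" for d z
  proof (induction d arbitrary: k z)
    case 0
    show ?case by (simp only: VN_0 VN_Suc) simp
  next
    case (Suc d)
    show ?case
      unfolding VN_Suc[of l0 l1 k] by (intro min.mono order_refl add_mono group_mean_mono Suc.IH)
  qed
  then show ?thesis by (intro decseq_SucI le_funI)
qed

text \<open>The value function \<open>V\<^sub>k\<close> of the problem without truncation, written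
  as an infimum because the truncated values decrease in the horizon.\<close>

definition V_lim :: "real \<Rightarrow> real \<Rightarrow> nat \<Rightarrow> ennreal \<Rightarrow> ennreal" where
  "V_lim l0 l1 k z = (INF d. VN l0 l1 (k + d) k z)"

lemma measurable_V_lim [measurable]: "V_lim l0 l1 k \<in> borel_measurable borel"
  unfolding V_lim_def[abs_def] by measurable

lemma V_lim_le: "V_lim l0 l1 k z \<le> ennreal l0"
proof -
  have "V_lim l0 l1 k z \<le> VN l0 l1 (k + 0) k z"
    unfolding V_lim_def by (rule INF_lower) simp
  then show ?thesis
    using g_le[of l0 l1 z] unfolding VN_0 by (rule order_trans)
qed

lemma VN_bar_LIMSEQ:
  assumes "1 \<le> k"
  shows "(\<lambda>d. VN_bar l0 l1 (k + d) k z) \<longlonglongrightarrow> group_mean k (V_lim l0 l1 k) z"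
proof -
  have "group_mean k (V_lim l0 l1 k) z = (INF d. VN_bar l0 l1 (k + d) k z)"
    unfolding V_lim_def[abs_def] VN_bar_def
  proof (rule group_mean_INF)
    show "VN l0 l1 (k + 0) k z \<le> ennreal l0" for z
      unfolding VN_0 by (rule g_le)
  qed (use assms VN_decseq measurable_VN in auto)
  moreover have "decseq (\<lambda>d. VN_bar l0 l1 (k + d) k z)"
    unfolding VN_bar_def
    by (intro decseq_SucI group_mean_mono le_funD[OF decseqD[OF VN_decseq]]) simp
  ultimately show ?thesis by (simp add: LIMSEQ_INF)
qed

text \<open>Shifting the horizon by \<open>k\<close> discards the finitely many horizons below
  \<open>k\<close> and leaves the limit unchanged. Integration and limit have thus been
  exchanged.\<close>

lemma V_bar_eq:
  assumes "1 \<le> k"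
  shows "V_bar l0 l1 k z = group_mean k (V_lim l0 l1 k) z"
proof -
  have "(\<lambda>N. VN_bar l0 l1 (N + k) k z) \<longlonglongrightarrow> group_mean k (V_lim l0 l1 k) z"
    using VN_bar_LIMSEQ[OF assms] by (simp add: add.commute)
  then show ?thesis
    unfolding V_bar_def by (intro limI) (rule LIMSEQ_offset)
qed

text \<open>Both sides are limits of the same truncated values: the left by definition, the right by
  continuity of minimum and addition in the truncated recursion.\<close>

lemma V_lim_rec:
  "V_lim l0 l1 k z = min (g l0 l1 z) (mean_cost G p c (Suc k) + V_bar l0 l1 (Suc k) z)"
proof (rule LIMSEQ_unique)
  have "decseq (\<lambda>d. VN l0 l1 (k + d) k z)"
    by (intro decseq_SucI le_funD[OF decseqD[OF VN_decseq]]) simp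
  then have "(\<lambda>d. VN l0 l1 (k + d) k z) \<longlonglongrightarrow> V_lim l0 l1 k z"
    unfolding V_lim_def by (rule LIMSEQ_INF)
  then show "(\<lambda>d. VN l0 l1 (k + Suc d) k z) \<longlonglongrightarrow> V_lim l0 l1 k z"
    by (rule LIMSEQ_Suc)
  show "(\<lambda>d. VN l0 l1 (k + Suc d) k z) \<longlonglongrightarrow>
      min (g l0 l1 z) (mean_cost G p c (Suc k) + V_bar l0 l1 (Suc k) z)"
    unfolding VN_Suc
    using VN_bar_LIMSEQ[of "Suc k" l0 l1 z]
    by (intro tendsto_min tendsto_add tendsto_const) (simp_all add: V_bar_eq VN_bar_def)
qed

lemma V_bar_le:
  assumes "1 \<le> k"
  shows "V_bar l0 l1 k z \<le> ennreal l0"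
  using group_mean_mono[of "V_lim l0 l1 k" "\<lambda>_. ennreal l0" k z, OF V_lim_le]
  by (simp add: V_bar_eq[OF assms] group_mean_const[OF assms])

lemma measurable_V_bar [measurable]:
  assumes "1 \<le> k"
  shows "V_bar l0 l1 k \<in> borel_measurable borel"
  unfolding V_bar_eq[OF assms, abs_def] by (rule measurable_group_mean) measurable

section \<open>Means over all group sizes of a stage\<close>

text \<open>Expectation under \<open>f0\<close> with the random group sizes averaged out as well.
  Both \<open>L\<close> and the condition in \<open>F0\<close> are series of such means.\<close>

definition size_mean :: "nat \<Rightarrow> (nat list \<Rightarrow> (nat \<Rightarrow> nat \<Rightarrow> 'a) \<Rightarrow> ennreal) \<Rightarrow> ennreal" where
  "size_mean k F = (\<Sum>\<^sub>\<infinity>n\<in>size_vectors k. ennreal (size_prob n) * E0 n (F n))"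

lemma size_mean_eq:
  "size_mean k F = (\<integral>\<^sup>+n. ennreal (size_prob n) * E0 n (F n) \<partial>count_space (size_vectors k))"
  unfolding size_mean_def by (simp add: infsum_eq_nn_integral_count_space)

lemma size_mean_mono:
  assumes "\<And>n x. n \<in> size_vectors k \<Longrightarrow> x \<in> space (data_measure n) \<Longrightarrow> 0 < joint_density f0 n x \<Longrightarrow> F n x \<le> H n x"
  shows "size_mean k F \<le> size_mean k H"
  unfolding size_mean_eq using assms by (intro nn_integral_mono mult_left_mono E0_mono) auto

lemma size_mean_cong:
  assumes "\<And>n x. n \<in> size_vectors k \<Longrightarrow> x \<in> space (data_measure n) \<Longrightarrow> 0 < joint_density f0 n x \<Longrightarrow> F n x = H n x"
  shows "size_mean k F = size_mean k H"
  by (rule antisym; rule size_mean_mono) (simp_all add: assms)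

lemma size_mean_add:
  assumes "\<And>n. n \<in> size_vectors k \<Longrightarrow> F n \<in> borel_measurable (data_measure n)"
    and "\<And>n. n \<in> size_vectors k \<Longrightarrow> H n \<in> borel_measurable (data_measure n)"
  shows "size_mean k (\<lambda>n x. F n x + H n x) = size_mean k F + size_mean k H"
proof -
  have "size_mean k (\<lambda>n x. F n x + H n x) = (\<integral>\<^sup>+n. ennreal (size_prob n) * E0 n (F n)
      + ennreal (size_prob n) * E0 n (H n) \<partial>count_space (size_vectors k))"
    unfolding size_mean_eq using assms by (intro nn_integral_cong) (simp add: E0_add distrib_left)
  then show ?thesis by (simp add: size_mean_eq nn_integral_add)
qed

lemma size_mean_cmult:
  assumes "\<And>n. n \<in> size_vectors k \<Longrightarrow> F n \<in> borel_measurable (data_measure n)"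
  shows "size_mean k (\<lambda>n x. a * F n x) = a * size_mean k F"
proof -
  have "size_mean k (\<lambda>n x. a * F n x) =
      (\<integral>\<^sup>+n. a * (ennreal (size_prob n) * E0 n (F n)) \<partial>count_space (size_vectors k))"
    unfolding size_mean_eq using assms by (intro nn_integral_cong) (simp add: E0_cmult mult_ac)
  then show ?thesis by (simp add: size_mean_eq nn_integral_cmult)
qed

text \<open>A sum of nonnegative terms vanishes only termwise, and a term with
  \<open>size_prob n = 0\<close> imposes no condition. This is the source of the restriction to
  possible sizes in \<open>S_infty\<close>.\<close>

lemma size_mean_eq_0_iff:
  assumes "\<And>n. n \<in> size_vectors k \<Longrightarrow> F n \<in> borel_measurable (data_measure n)"
  shows "size_mean k F = 0 \<longleftrightarrow>
    (\<forall>n\<in>possible_sizes k. AE x in data_measure n. 0 < joint_density f0 n x \<longrightarrow> F n x = 0)"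
proof -
  have "size_mean k F = 0 \<longleftrightarrow> (\<forall>n\<in>size_vectors k. ennreal (size_prob n) * E0 n (F n) = 0)"
    unfolding size_mean_eq by (simp add: nn_integral_0_iff_AE AE_count_space)
  also have "\<dots> \<longleftrightarrow> (\<forall>n\<in>possible_sizes k. E0 n (F n) = 0)"
    by (auto simp: possible_sizes_def ennreal_eq_0_iff not_le)
  also have "\<dots> \<longleftrightarrow> (\<forall>n\<in>possible_sizes k. AE x in data_measure n. 0 < joint_density f0 n x \<longrightarrow> F n x = 0)"
    using assms by (intro ball_cong refl E0_eq_0_iff) (auto simp: possible_sizes_def)
  finally show ?thesis .
qed

lemma bij_betw_size_vectors_Suc:
  "bij_betw (\<lambda>(n, m). n @ [m]) (size_vectors k \<times> G) (size_vectors (Suc k))"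
proof (rule bij_betwI')
  fix l assume "l \<in> size_vectors (Suc k)"
  then show "\<exists>nm\<in>size_vectors k \<times> G. l = (case nm of (n, m) \<Rightarrow> n @ [m])"
    by (cases l rule: rev_cases) (auto simp: size_vectors_def)
qed (auto simp: size_vectors_def)

lemma size_prob_snoc: "size_prob (n @ [m]) = size_prob n * pmf (p (Suc (length n))) m"
  by (simp add: size_prob_def lessThan_Suc nth_append mult.commute)

lemma size_prob_nonneg: "0 \<le> size_prob n"
  by (simp add: size_prob_def prod_nonneg)

lemma cost_snoc: "cost (n @ [m]) = cost n + c m"
  by (simp add: cost_def lessThan_Suc nth_append)

lemma cost_nonneg: "n \<in> size_vectors k \<Longrightarrow> 0 \<le> cost n"
  unfolding cost_def size_vectors_def using c_pos
  by (intro sum_nonneg) (auto simp: subset_iff less_imp_le)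

lemma cost_take_le: "n \<in> size_vectors j \<Longrightarrow> cost (take k n) \<le> cost n"
  unfolding cost_def size_vectors_def using c_pos
  by (auto simp: subset_iff less_imp_le intro!: sum_mono2)

text \<open>Tower rule: appending a size is a bijection onto the longer vectors, and both the size
  probability and the expectation factor along it.\<close>

lemma size_mean_Suc:
  assumes "\<And>n. n \<in> size_vectors (Suc k) \<Longrightarrow> F n \<in> borel_measurable (data_measure n)"
  shows "size_mean (Suc k) F = size_mean k (\<lambda>n x. \<integral>\<^sup>+m. ennreal (pmf (p (Suc k)) m) *
    E0 [m] (\<lambda>y. F (n @ [m]) (x(k := y 0))) \<partial>count_space G)"
proof -
  interpret C: sigma_finite_measure "count_space G"
    by (rule sigma_finite_measure_count_space_countable) simp
  let ?h = "\<lambda>n. ennreal (size_prob n) * E0 n (F n)"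
  have "size_mean (Suc k) F = (\<integral>\<^sup>+nm. ?h (fst nm @ [snd nm]) \<partial>count_space (size_vectors k \<times> G))"
    unfolding size_mean_eq
    by (subst nn_integral_bij_count_space[OF bij_betw_size_vectors_Suc, symmetric])
      (simp add: case_prod_beta')
  also have "\<dots> = (\<integral>\<^sup>+n. \<integral>\<^sup>+m. ?h (n @ [m]) \<partial>count_space G \<partial>count_space (size_vectors k))"
    using C.nn_integral_fst[of "\<lambda>nm. ?h (fst nm @ [snd nm])" "count_space (size_vectors k)"]
    by (simp add: pair_measure_countable)
  also have "\<dots> = size_mean k (\<lambda>n x. \<integral>\<^sup>+m. ennreal (pmf (p (Suc k)) m) *
    E0 [m] (\<lambda>y. F (n @ [m]) (x(k := y 0))) \<partial>count_space G)"
    unfolding size_mean_eq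
  proof (rule nn_integral_cong)
    fix n assume "n \<in> space (count_space (size_vectors k))"
    then have n: "n \<in> size_vectors k" "length n = k" by (auto simp: size_vectors_def)
    have meas: "F (n @ [m]) \<in> borel_measurable (data_measure (n @ [m]))" if "m \<in> G" for m
      using n that by (intro assms) (auto simp: size_vectors_def)
    note meas' = measurable_E0_snoc[OF meas, unfolded n]
    have "?h (n @ [m]) = ennreal (size_prob n) *
        E0 n (\<lambda>x. ennreal (pmf (p (Suc k)) m) * E0 [m] (\<lambda>y. F (n @ [m]) (x(k := y 0))))"
      if "m \<in> G" for m
      using E0_snoc[OF meas[OF that]] n meas'[OF that]
      by (simp add: size_prob_snoc size_prob_nonneg ennreal_mult E0_cmult mult_ac)
    then have "(\<integral>\<^sup>+m. ?h (n @ [m]) \<partial>count_space G) = (\<integral>\<^sup>+m. ennreal (size_prob n) *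
        E0 n (\<lambda>x. ennreal (pmf (p (Suc k)) m) * E0 [m] (\<lambda>y. F (n @ [m]) (x(k := y 0)))) \<partial>count_space G)"
      by (intro nn_integral_cong) simp
    \<comment> \<open>Tonelli exchanges the sum over the new size with the expectation over the
      earlier groups.\<close>
    also have "\<dots> = ennreal (size_prob n) * E0 n (\<lambda>x. \<integral>\<^sup>+m. ennreal (pmf (p (Suc k)) m) *
        E0 [m] (\<lambda>y. F (n @ [m]) (x(k := y 0))) \<partial>count_space G)"
      using meas' by (subst E0_count_space) (auto simp: nn_integral_cmult)
    finally show "(\<integral>\<^sup>+m. ?h (n @ [m]) \<partial>count_space G) = \<dots>" .
  qed
  finally show ?thesis .
qed

section \<open>Stopping rules\<close>

lemma stopping_ruleD:
  assumes "stopping_rule \<psi>" "n \<in> size_vectors k" "1 \<le> k"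
  shows "\<psi> n \<in> borel_measurable (data_measure n)"
    and "x \<in> space (data_measure n) \<Longrightarrow> 0 \<le> \<psi> n x"
    and "x \<in> space (data_measure n) \<Longrightarrow> \<psi> n x \<le> 1"
  using assms unfolding stopping_rule_def by auto

lemma measurable_restrict_groups:
  assumes "i \<le> length n"
  shows "(\<lambda>x. restrict x {..<i}) \<in> measurable (data_measure n) (data_measure (take i n))"
proof -
  have "data_measure (take i n) = (\<Pi>\<^sub>M j\<in>{..<i}. block n j)"
    unfolding data_measure_def using assms by (intro PiM_cong) auto
  then show ?thesis
    using assms unfolding data_measure_def[of n] by (auto intro!: measurable_restrict_subset)
qed

lemma take_in_size_vectors: "n \<in> size_vectors k \<Longrightarrow> i \<le> k \<Longrightarrow> take i n \<in> size_vectors i"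
  by (auto simp: size_vectors_def dest: in_set_takeD)

lemma measurable_t:
  assumes "stopping_rule \<psi>" "n \<in> size_vectors k"
  shows "t \<psi> n \<in> borel_measurable (data_measure n)"
  unfolding t_def
proof (intro borel_measurable_prod borel_measurable_diff borel_measurable_const)
  fix i assume "i \<in> {1..<length n}"
  then have i: "1 \<le> i" "i \<le> length n" "i \<le> k" using assms(2) by (auto simp: size_vectors_def)
  show "(\<lambda>x. \<psi> (take i n) (restrict x {..<i})) \<in> borel_measurable (data_measure n)"
    by (rule measurable_compose[OF measurable_restrict_groups[OF i(2)]
          stopping_ruleD(1)[OF assms(1) take_in_size_vectors[OF assms(2) i(3)] i(1)]])
qed

lemma t_nonneg:
  assumes "stopping_rule \<psi>" "n \<in> size_vectors k" "x \<in> space (data_measure n)"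
  shows "0 \<le> t \<psi> n x"
  unfolding t_def
proof (rule prod_nonneg)
  fix i assume "i \<in> {1..<length n}"
  then have i: "1 \<le> i" "i \<le> length n" "i \<le> k" using assms(2) by (auto simp: size_vectors_def)
  show "0 \<le> 1 - \<psi> (take i n) (restrict x {..<i})"
    using stopping_ruleD(3)[OF assms(1) take_in_size_vectors[OF assms(2) i(3)] i(1)]
      measurable_space[OF measurable_restrict_groups[OF i(2)] assms(3)] by simp
qed

lemma t_single: "length n = 1 \<Longrightarrow> t \<psi> n x = 1"
  by (simp add: t_def)

text \<open>Decisions up to stage \<open>length n\<close> do not see the new group, so
  \<open>w\<close> is arbitrary. At least one group must be present, since no decision is taken
  before the first.\<close>

lemma t_snoc:
  assumes "x \<in> space (data_measure n)" "1 \<le> length n"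
  shows "t \<psi> (n @ [m]) (x(length n := w)) = t \<psi> n x * (1 - \<psi> n x)"
proof -
  have "restrict (x(length n := w)) {..<i} = restrict x {..<i}" if "i \<le> length n" for i
    using that by (auto simp: restrict_def)
  \<comment> \<open>Points of a product space are extensional, so restricting to all present groups
    changes nothing.\<close>
  moreover have "restrict x {..<length n} = x"
    using assms(1) by (simp add: data_measure_def space_PiM PiE_restrict)
  moreover have "{1..<Suc (length n)} = insert (length n) {1..<length n}"
    using assms(2) by auto
  ultimately show ?thesis by (simp add: t_def mult.commute)
qed

text \<open>Where both densities under \<open>f0\<close> are positive, all three ratios are ordinary
  quotients and the joint densities multiply.\<close>

lemma lik_ratio_snoc:
  assumes "x \<in> space (data_measure n)" "y \<in> space (data_measure [m])"
    and "0 < joint_density f0 n x" "0 < joint_density f0 [m] y"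
  shows "lik_ratio (n @ [m]) (x(length n := y 0)) = lik_ratio n x * lik_ratio [m] y"
  using assms joint_density_nonneg(2)[OF assms(1)] joint_density_nonneg(2)[OF assms(2)]
  by (simp add: lik_ratio_def joint_density_snoc flip: ennreal_mult)

text \<open>Whether stage \<open>Suc k\<close> is reached is decided by the first \<open>k\<close>
  groups, so this factor leaves the inner mean over the next group.\<close>

lemma size_mean_Suc_t:
  assumes \<psi>: "stopping_rule \<psi>" and "1 \<le> k"
    and F: "\<And>n. n \<in> size_vectors (Suc k) \<Longrightarrow> F n \<in> borel_measurable (data_measure n)"
  shows "size_mean (Suc k) (\<lambda>n x. ennreal (t \<psi> n x) * F n x) =
    size_mean k (\<lambda>n x. ennreal (t \<psi> n x * (1 - \<psi> n x)) *
      (\<integral>\<^sup>+m. ennreal (pmf (p (Suc k)) m) * E0 [m] (\<lambda>y. F (n @ [m]) (x(k := y 0))) \<partial>count_space G))"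
proof -
  have "size_mean (Suc k) (\<lambda>n x. ennreal (t \<psi> n x) * F n x) =
    size_mean k (\<lambda>n x. \<integral>\<^sup>+m. ennreal (pmf (p (Suc k)) m) *
      E0 [m] (\<lambda>y. ennreal (t \<psi> (n @ [m]) (x(k := y 0))) * F (n @ [m]) (x(k := y 0))) \<partial>count_space G)"
    using measurable_t[OF \<psi>] F by (intro size_mean_Suc) (auto intro!: borel_measurable_times_ennreal)
  also have "\<dots> = size_mean k (\<lambda>n x. ennreal (t \<psi> n x * (1 - \<psi> n x)) *
      (\<integral>\<^sup>+m. ennreal (pmf (p (Suc k)) m) * E0 [m] (\<lambda>y. F (n @ [m]) (x(k := y 0))) \<partial>count_space G))"
  proof (rule size_mean_cong)
    fix n x assume n: "n \<in> size_vectors k" and x: "x \<in> space (data_measure n)"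
    then have len: "length n = k" by (simp add: size_vectors_def)
    have "E0 [m] (\<lambda>y. ennreal (t \<psi> (n @ [m]) (x(k := y 0))) * F (n @ [m]) (x(k := y 0))) =
      ennreal (t \<psi> n x * (1 - \<psi> n x)) * E0 [m] (\<lambda>y. F (n @ [m]) (x(k := y 0)))" if "m \<in> G" for m
    proof -
      have "F (n @ [m]) \<in> borel_measurable (data_measure (n @ [m]))"
        using n that by (intro F) (auto simp: size_vectors_def)
      from E0_cmult[OF measurable_compose[OF measurable_update_group_right[OF x] this]]
      show ?thesis using t_snoc[OF x] len \<open>1 \<le> k\<close> by simp
    qed
    then have "(\<integral>\<^sup>+m. ennreal (pmf (p (Suc k)) m) *
        E0 [m] (\<lambda>y. ennreal (t \<psi> (n @ [m]) (x(k := y 0))) * F (n @ [m]) (x(k := y 0))) \<partial>count_space G)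
      = (\<integral>\<^sup>+m. ennreal (t \<psi> n x * (1 - \<psi> n x)) * (ennreal (pmf (p (Suc k)) m) *
        E0 [m] (\<lambda>y. F (n @ [m]) (x(k := y 0)))) \<partial>count_space G)"
      by (intro nn_integral_cong) (simp add: mult_ac)
    also have "\<dots> = ennreal (t \<psi> n x * (1 - \<psi> n x)) *
      (\<integral>\<^sup>+m. ennreal (pmf (p (Suc k)) m) * E0 [m] (\<lambda>y. F (n @ [m]) (x(k := y 0))) \<partial>count_space G)"
      by (simp add: nn_integral_cmult)
    finally show "(\<integral>\<^sup>+m. ennreal (pmf (p (Suc k)) m) *
        E0 [m] (\<lambda>y. ennreal (t \<psi> (n @ [m]) (x(k := y 0))) * F (n @ [m]) (x(k := y 0))) \<partial>count_space G) = \<dots>" .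
  qed
  finally show ?thesis .
qed

text \<open>The weight \<open>h\<close> does not depend on the new group, so the inner mean is that
  of a constant.\<close>

lemma size_mean_Suc_t_take:
  assumes "stopping_rule \<psi>" "1 \<le> k"
  shows "size_mean (Suc k) (\<lambda>n x. ennreal (t \<psi> n x) * h (take k n)) =
    size_mean k (\<lambda>n x. ennreal (t \<psi> n x * (1 - \<psi> n x)) * h n)"
proof -
  have "size_mean (Suc k) (\<lambda>n x. ennreal (t \<psi> n x) * h (take k n)) =
    size_mean k (\<lambda>n x. ennreal (t \<psi> n x * (1 - \<psi> n x)) *
      (\<integral>\<^sup>+m. ennreal (pmf (p (Suc k)) m) * E0 [m] (\<lambda>y. h (take k (n @ [m]))) \<partial>count_space G))"
    by (rule size_mean_Suc_t[OF assms]) simp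
  also have "\<dots> = size_mean k (\<lambda>n x. ennreal (t \<psi> n x * (1 - \<psi> n x)) * h n)"
    by (rule size_mean_cong)
      (simp add: size_vectors_def E0_const nn_integral_multc size_probability)
  finally show ?thesis .
qed

text \<open>Cost is additive and the likelihood ratio multiplicative over groups. Hence the observed
  data influence the future only through the current ratio.\<close>

lemma one_group_mean:
  assumes [measurable]: "W \<in> borel_measurable borel"
    and n: "n \<in> size_vectors k" and x: "x \<in> space (data_measure n)" "0 < joint_density f0 n x"
  shows "(\<integral>\<^sup>+m. ennreal (pmf (p (Suc k)) m) * E0 [m] (\<lambda>y. ennreal (cost (n @ [m])) +
      W (lik_ratio (n @ [m]) (x(k := y 0)))) \<partial>count_space G) =
    ennreal (cost n) + (mean_cost G p c (Suc k) + group_mean (Suc k) W (lik_ratio n x))"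
proof -
  have len: "length n = k" using n by (simp add: size_vectors_def)
  have "E0 [m] (\<lambda>y. ennreal (cost (n @ [m])) + W (lik_ratio (n @ [m]) (x(k := y 0)))) =
      ennreal (cost n) + ennreal (c m) + E0 [m] (\<lambda>y. W (lik_ratio n x * lik_ratio [m] y))"
    if "m \<in> G" for m
  proof -
    have "E0 [m] (\<lambda>y. ennreal (cost (n @ [m])) + W (lik_ratio (n @ [m]) (x(k := y 0)))) =
      E0 [m] (\<lambda>y. (ennreal (cost n) + ennreal (c m)) + W (lik_ratio n x * lik_ratio [m] y))"
      using lik_ratio_snoc[OF x(1) _ x(2)] len cost_nonneg[OF n] c_pos[OF that]
      by (intro E0_cong) (simp add: cost_snoc ennreal_plus)
    also have "\<dots> = E0 [m] (\<lambda>_. ennreal (cost n) + ennreal (c m)) +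
      E0 [m] (\<lambda>y. W (lik_ratio n x * lik_ratio [m] y))"
      by (rule E0_add) measurable
    finally show ?thesis by (simp add: E0_const)
  qed
  then have "(\<integral>\<^sup>+m. ennreal (pmf (p (Suc k)) m) * E0 [m] (\<lambda>y. ennreal (cost (n @ [m])) +
      W (lik_ratio (n @ [m]) (x(k := y 0)))) \<partial>count_space G) =
    (\<integral>\<^sup>+m. ennreal (pmf (p (Suc k)) m) * ennreal (cost n) + (ennreal (pmf (p (Suc k)) m * c m) +
      ennreal (pmf (p (Suc k)) m) * E0 [m] (\<lambda>y. W (lik_ratio n x * lik_ratio [m] y))) \<partial>count_space G)"
    using c_pos by (intro nn_integral_cong) (simp add: distrib_left ennreal_mult less_imp_le add.assoc)
  then show ?thesis
    by (simp add: nn_integral_add nn_integral_multc size_probability group_mean_eq mean_cost_def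
        infsum_eq_nn_integral_count_space)
qed

lemma measurable_cost_add:
  assumes [measurable]: "W \<in> borel_measurable borel"
  shows "(\<lambda>x. ennreal (cost n) + W (lik_ratio n x)) \<in> borel_measurable (data_measure n)"
  by measurable

lemma size_mean_Suc_cost:
  assumes "stopping_rule \<psi>" "1 \<le> k" "W \<in> borel_measurable borel"
  shows "size_mean (Suc k) (\<lambda>n x. ennreal (t \<psi> n x) * (ennreal (cost n) + W (lik_ratio n x))) =
    size_mean k (\<lambda>n x. ennreal (t \<psi> n x * (1 - \<psi> n x)) *
      (ennreal (cost n) + (mean_cost G p c (Suc k) + group_mean (Suc k) W (lik_ratio n x))))"
  unfolding size_mean_Suc_t[OF assms(1,2) measurable_cost_add[OF assms(3)]]
  by (rule size_mean_cong) (simp add: one_group_mean[OF assms(3)])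

lemma size_mean_0: "size_mean 0 (\<lambda>_ _. a) = a"
proof -
  have "size_vectors 0 = {[]}" by (auto simp: size_vectors_def)
  then show ?thesis by (simp add: size_mean_def size_prob_def E0_const)
qed

lemma size_mean_1_cost:
  assumes "W \<in> borel_measurable borel"
  shows "size_mean 1 (\<lambda>n x. ennreal (t \<psi> n x) * (ennreal (cost n) + W (lik_ratio n x))) =
    mean_cost G p c 1 + group_mean 1 W 1"
proof -
  have "size_mean 1 (\<lambda>n x. ennreal (t \<psi> n x) * (ennreal (cost n) + W (lik_ratio n x))) =
    size_mean (Suc 0) (\<lambda>n x. ennreal (cost n) + W (lik_ratio n x))"
    by (auto intro!: size_mean_cong simp: t_single size_vectors_def)
  also have "\<dots> = size_mean 0 (\<lambda>n x. \<integral>\<^sup>+m. ennreal (pmf (p (Suc 0)) m) * E0 [m] (\<lambda>y. ennreal (cost (n @ [m])) +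
      W (lik_ratio (n @ [m]) (x(0 := y 0)))) \<partial>count_space G)"
    by (rule size_mean_Suc[OF measurable_cost_add[OF assms]])
  also have "\<dots> = size_mean 0 (\<lambda>n x. mean_cost G p c 1 + group_mean 1 W 1)"
  proof (rule size_mean_cong)
    fix n x assume *: "n \<in> size_vectors 0" "x \<in> space (data_measure n)" "0 < joint_density f0 n x"
    \<comment> \<open>Before any group is observed the cost is 0 and the likelihood ratio is an
      empty product, whence the argument 1.\<close>
    then have "n = []" by (simp add: size_vectors_def)
    then show "(\<integral>\<^sup>+m. ennreal (pmf (p (Suc 0)) m) * E0 [m] (\<lambda>y. ennreal (cost (n @ [m])) +
      W (lik_ratio (n @ [m]) (x(0 := y 0)))) \<partial>count_space G) = mean_cost G p c 1 + group_mean 1 W 1"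
      unfolding one_group_mean[OF assms *] by (simp add: cost_def lik_ratio_def joint_density_def)
  qed
  finally show ?thesis by (simp only: size_mean_0)
qed

section \<open>Comparison of costs\<close>

lemma mixture_ge_min:
  assumes "0 \<le> u" "u \<le> 1"
  shows "min a b \<le> ennreal u * a + ennreal (1 - u) * b"
proof -
  have "min a b = ennreal u * min a b + ennreal (1 - u) * min a b"
    using assms by (simp flip: distrib_right ennreal_plus)
  also have "\<dots> \<le> ennreal u * a + ennreal (1 - u) * b"
    by (intro add_mono mult_left_mono) auto
  finally show ?thesis .
qed

text \<open>The excess over the minimum is the weight of the larger term times the difference of the
  two terms. At a tie it vanishes for every \<open>u\<close>, and the indicators then allow every
  \<open>u\<close> in the unit interval. Finiteness moves the computation to the reals.\<close>

lemma mixture_diff_min_eq_0_iff: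
  assumes u: "0 \<le> u" "u \<le> 1" and "a < top" "b < top"
  shows "ennreal u * a + ennreal (1 - u) * b - min a b = 0 \<longleftrightarrow> between_indicators u a b"
proof -
  obtain a' b' where ab: "0 \<le> a'" "a = ennreal a'" "0 \<le> b'" "b = ennreal b'"
    using assms by (metis less_top_ennreal)
  have "min a b = ennreal (min a' b')" using ab by (simp add: min_def)
  then have "ennreal u * a + ennreal (1 - u) * b - min a b =
      ennreal (u * a' + (1 - u) * b' - min a' b')"
    using ab u by (simp add: ennreal_minus flip: ennreal_mult ennreal_plus)
  also have "\<dots> = 0 \<longleftrightarrow> u * a' + (1 - u) * b' \<le> min a' b'"
    by (simp add: ennreal_eq_0_iff)
  also have "\<dots> \<longleftrightarrow> between_indicators u a b"
  proof (cases a' b' rule: linorder_cases)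
    case less
    then have "u * a' + (1 - u) * b' - min a' b' = (1 - u) * (b' - a')"
      by (simp add: algebra_simps)
    then have "u * a' + (1 - u) * b' \<le> min a' b' \<longleftrightarrow> (1 - u) * (b' - a') \<le> 0" by linarith
    then show ?thesis
      using less ab u by (auto simp: between_indicators_def mult_le_0_iff ennreal_less_iff)
  next
    case equal
    then show ?thesis using ab u by (simp add: between_indicators_def algebra_simps)
  next
    case greater
    then have "u * a' + (1 - u) * b' - min a' b' = u * (a' - b')"
      by (simp add: algebra_simps)
    then have "u * a' + (1 - u) * b' \<le> min a' b' \<longleftrightarrow> u * (a' - b') \<le> 0" by linarith
    then show ?thesis
      using greater ab u by (auto simp: between_indicators_def mult_le_0_iff ennreal_less_iff)
  qed
  finally show ?thesis .
qed

definition stopped_cost :: "real \<Rightarrow> real \<Rightarrow> (nat list \<Rightarrow> (nat \<Rightarrow> nat \<Rightarrow> 'a) \<Rightarrow> real) \<Rightarrow> nat \<Rightarrow> ennreal" where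
  "stopped_cost l0 l1 \<psi> k =
     size_mean k (\<lambda>n x. ennreal (s \<psi> n x) * (ennreal (cost n) + g l0 l1 (lik_ratio n x)))"

definition running_cost :: "real \<Rightarrow> real \<Rightarrow> (nat list \<Rightarrow> (nat \<Rightarrow> nat \<Rightarrow> 'a) \<Rightarrow> real) \<Rightarrow> nat \<Rightarrow> ennreal" where
  "running_cost l0 l1 \<psi> k =
     size_mean k (\<lambda>n x. ennreal (t \<psi> n x) * (ennreal (cost n) + V_lim l0 l1 k (lik_ratio n x)))"

text \<open>The subtraction is truncated at 0, but loses nothing here: for a stopping rule the
  mixture is at least the minimum given by the Bellman equation.\<close>

definition gap :: "real \<Rightarrow> real \<Rightarrow> (nat list \<Rightarrow> (nat \<Rightarrow> nat \<Rightarrow> 'a) \<Rightarrow> real) \<Rightarrow> nat \<Rightarrow> ennreal" where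
  "gap l0 l1 \<psi> k = size_mean k (\<lambda>n x. ennreal (t \<psi> n x) *
     (ennreal (\<psi> n x) * g l0 l1 (lik_ratio n x) + ennreal (1 - \<psi> n x) *
        (mean_cost G p c (Suc k) + V_bar l0 l1 (Suc k) (lik_ratio n x)) - V_lim l0 l1 k (lik_ratio n x)))"

section \<open>The one-stage cost identity and its telescoping sum\<close>

lemma measurable_stopping:
  assumes "stopping_rule \<psi>" "n \<in> size_vectors k" "1 \<le> k"
  shows "(\<lambda>x. ennreal (t \<psi> n x)) \<in> borel_measurable (data_measure n)"
    and "(\<lambda>x. ennreal (s \<psi> n x)) \<in> borel_measurable (data_measure n)"
    and "(\<lambda>x. ennreal (\<psi> n x)) \<in> borel_measurable (data_measure n)"
    and "(\<lambda>x. ennreal (1 - \<psi> n x)) \<in> borel_measurable (data_measure n)"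
    and "(\<lambda>x. ennreal (t \<psi> n x * (1 - \<psi> n x))) \<in> borel_measurable (data_measure n)"
  using measurable_t[OF assms(1,2)] stopping_ruleD(1)[OF assms] unfolding s_def by measurable

lemma measurable_gap:
  assumes "stopping_rule \<psi>" "n \<in> size_vectors k" "1 \<le> k"
  shows "(\<lambda>x. ennreal (t \<psi> n x) *
     (ennreal (\<psi> n x) * g l0 l1 (lik_ratio n x) + ennreal (1 - \<psi> n x) *
        (mean_cost G p c (Suc k) + V_bar l0 l1 (Suc k) (lik_ratio n x)) - V_lim l0 l1 k (lik_ratio n x)))
    \<in> borel_measurable (data_measure n)"
proof -
  note measurable_stopping[OF assms, measurable] measurable_V_bar[of "Suc k" l0 l1, simplified, measurable]
  show ?thesis by measurable
qed

text \<open>The tower rule turns the next running cost into a mean at stage \<open>k\<close>. There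
  the two sides agree pointwise: stopping and continuing together cost the value
  \<open>V_lim\<close> plus the excess of the mixture.\<close>

lemma cost_step:
  assumes \<psi>: "stopping_rule \<psi>" and k: "1 \<le> k"
  shows "stopped_cost l0 l1 \<psi> k + running_cost l0 l1 \<psi> (Suc k) =
    running_cost l0 l1 \<psi> k + gap l0 l1 \<psi> k"
proof -
  let ?c = "\<lambda>n. ennreal (cost n)"
  let ?a = "\<lambda>n x. g l0 l1 (lik_ratio n x)"
  let ?b = "\<lambda>n x. mean_cost G p c (Suc k) + V_bar l0 l1 (Suc k) (lik_ratio n x)"
  let ?v = "\<lambda>n x. V_lim l0 l1 k (lik_ratio n x)"
  note meas = measurable_stopping[OF \<psi> _ k]
  have meas_b: "?b n \<in> borel_measurable (data_measure n)" for n
  proof -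
    note measurable_V_bar[of "Suc k" l0 l1, simplified, measurable]
    show ?thesis by measurable
  qed
  have "running_cost l0 l1 \<psi> (Suc k) =
      size_mean k (\<lambda>n x. ennreal (t \<psi> n x * (1 - \<psi> n x)) * (?c n + ?b n x))"
    unfolding running_cost_def size_mean_Suc_cost[OF \<psi> k measurable_V_lim]
    by (simp add: V_bar_eq)
  then have "stopped_cost l0 l1 \<psi> k + running_cost l0 l1 \<psi> (Suc k) =
      size_mean k (\<lambda>n x. ennreal (s \<psi> n x) * (?c n + ?a n x) +
        ennreal (t \<psi> n x * (1 - \<psi> n x)) * (?c n + ?b n x))"
    unfolding stopped_cost_def using meas meas_b
    by (subst size_mean_add) (auto intro!: borel_measurable_times_ennreal)
  also have "\<dots> = size_mean k (\<lambda>n x. ennreal (t \<psi> n x) * (?c n + ?v n x) + ennreal (t \<psi> n x) *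
      (ennreal (\<psi> n x) * ?a n x + ennreal (1 - \<psi> n x) * ?b n x - ?v n x))"
  proof (rule size_mean_cong)
    fix n x assume n: "n \<in> size_vectors k" and x: "x \<in> space (data_measure n)"
    note t = t_nonneg[OF \<psi> n x] and u = stopping_ruleD(2,3)[OF \<psi> n k x]
    let ?m = "ennreal (\<psi> n x) * ?a n x + ennreal (1 - \<psi> n x) * ?b n x"
    \<comment> \<open>This inequality lets the truncated subtraction cancel.\<close>
    have "?v n x \<le> ?m"
      unfolding V_lim_rec by (rule mixture_ge_min[OF u])
    then have "ennreal (t \<psi> n x) * (?c n + ?v n x) + ennreal (t \<psi> n x) * (?m - ?v n x)
        = ennreal (t \<psi> n x) * (?c n + ?m)"
      by (simp add: add.assoc add_diff_inverse_ennreal flip: distrib_left)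
    \<comment> \<open>The accumulated cost is shared out with the weights of stopping and
      continuing, to be regrouped with the two terms.\<close>
    also have "\<dots> = ennreal (t \<psi> n x) * ((ennreal (\<psi> n x) + ennreal (1 - \<psi> n x)) * ?c n + ?m)"
      using u by (simp flip: ennreal_plus)
    also have "\<dots> =
        ennreal (s \<psi> n x) * (?c n + ?a n x) + ennreal (t \<psi> n x * (1 - \<psi> n x)) * (?c n + ?b n x)"
      using t u unfolding s_def by (simp add: ennreal_mult distrib_left distrib_right mult_ac add_ac)
    finally show "ennreal (s \<psi> n x) * (?c n + ?a n x) +
        ennreal (t \<psi> n x * (1 - \<psi> n x)) * (?c n + ?b n x) =
      ennreal (t \<psi> n x) * (?c n + ?v n x) + ennreal (t \<psi> n x) * (?m - ?v n x)" by simp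
  qed
  also have "\<dots> = running_cost l0 l1 \<psi> k + gap l0 l1 \<psi> k"
    unfolding running_cost_def gap_def using measurable_gap[OF \<psi> _ k] meas
    by (intro size_mean_add) (auto intro!: borel_measurable_times_ennreal)
  finally show ?thesis .
qed

lemma running_cost_1: "running_cost l0 l1 \<psi> 1 = mean_cost G p c 1 + V_bar l0 l1 1 1"
  unfolding running_cost_def size_mean_1_cost[OF measurable_V_lim] by (simp add: V_bar_eq)

text \<open>Each use of \<open>cost_step\<close> trades a running cost for the next one. The
  additive form avoids subtracting possibly infinite quantities.\<close>

lemma cost_telescope:
  assumes "stopping_rule \<psi>"
  shows "(\<Sum>j<K. stopped_cost l0 l1 \<psi> (Suc j)) + running_cost l0 l1 \<psi> (Suc K) =
    mean_cost G p c 1 + V_bar l0 l1 1 1 + (\<Sum>j<K. gap l0 l1 \<psi> (Suc j))"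
proof (induction K)
  case 0
  show ?case using running_cost_1[of l0 l1 \<psi>] by simp
next
  case (Suc K)
  then show ?case
    using cost_step[OF assms, of "Suc K" l0 l1] by (simp add: add.assoc)
qed

text \<open>The integrand vanishes where \<open>t\<close> is 0, which is off \<open>T\<close>, or
  where the mixture attains the minimum. Both terms are finite, being bounded by \<open>l0\<close>
  and by a finite mean cost plus \<open>l0\<close>.\<close>

lemma gap_eq_0_iff:
  assumes \<psi>: "stopping_rule \<psi>" and k: "1 \<le> k"
  shows "gap l0 l1 \<psi> k = 0 \<longleftrightarrow> (\<forall>n\<in>possible_sizes k.
     AE x in data_measure n. x \<in> T \<psi> n \<and> 0 < joint_density f0 n x \<longrightarrow>
       between_indicators (\<psi> n x) (g l0 l1 (lik_ratio n x))
         (mean_cost G p c (Suc k) + V_bar l0 l1 (Suc k) (lik_ratio n x)))"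
  unfolding gap_def
proof (subst size_mean_eq_0_iff, erule measurable_gap[OF \<psi> _ k], intro ball_cong refl AE_cong)
  fix n x assume "n \<in> possible_sizes k" and x: "x \<in> space (data_measure n)"
  then have n: "n \<in> size_vectors k" by (simp add: possible_sizes_def)
  have "g l0 l1 (lik_ratio n x) < top"
    using g_le by (rule le_less_trans) simp
  moreover have "mean_cost G p c (Suc k) + V_bar l0 l1 (Suc k) (lik_ratio n x) < top"
    using mean_cost_finite[of "Suc k"] le_less_trans[OF V_bar_le[of "Suc k" l0 l1], of top] by simp
  ultimately show "(0 < joint_density f0 n x \<longrightarrow> ennreal (t \<psi> n x) *
     (ennreal (\<psi> n x) * g l0 l1 (lik_ratio n x) + ennreal (1 - \<psi> n x) *
        (mean_cost G p c (Suc k) + V_bar l0 l1 (Suc k) (lik_ratio n x)) - V_lim l0 l1 k (lik_ratio n x)) = 0) \<longleftrightarrow>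
    (x \<in> T \<psi> n \<and> 0 < joint_density f0 n x \<longrightarrow>
       between_indicators (\<psi> n x) (g l0 l1 (lik_ratio n x))
         (mean_cost G p c (Suc k) + V_bar l0 l1 (Suc k) (lik_ratio n x)))"
    using mixture_diff_min_eq_0_iff[OF stopping_ruleD(2,3)[OF \<psi> n k x]] x
    unfolding V_lim_rec by (auto simp: T_def ennreal_eq_0_iff not_le)
qed

lemma S_infty_iff_gap:
  assumes "stopping_rule \<psi>"
  shows "S_infty l0 l1 \<psi> \<longleftrightarrow> (\<forall>k\<ge>1. gap l0 l1 \<psi> k = 0)"
  unfolding S_infty_def using gap_eq_0_iff[OF assms] by blast

text \<open>Every run reaching stage \<open>Suc k\<close> either stops within the next
  \<open>M\<close> stages or is still going after them. The weight \<open>h\<close> sees only the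
  first \<open>Suc k\<close> sizes and so is carried along unchanged.\<close>

lemma size_mean_t_take:
  assumes \<psi>: "stopping_rule \<psi>"
  shows "size_mean (Suc k) (\<lambda>n x. ennreal (t \<psi> n x) * h (take (Suc k) n)) =
    (\<Sum>j<M. size_mean (Suc (j + k)) (\<lambda>n x. ennreal (s \<psi> n x) * h (take (Suc k) n))) +
    size_mean (Suc (M + k)) (\<lambda>n x. ennreal (t \<psi> n x) * h (take (Suc k) n))"
proof (induction M)
  case 0
  show ?case by simp
next
  case (Suc M)
  let ?K = "Suc (M + k)"
  have K: "1 \<le> ?K" by simp
  have "size_mean ?K (\<lambda>n x. ennreal (t \<psi> n x) * h (take (Suc k) n)) =
    size_mean ?K (\<lambda>n x. ennreal (s \<psi> n x) * h (take (Suc k) n) +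
      ennreal (t \<psi> n x * (1 - \<psi> n x)) * h (take (Suc k) n))"
  proof (rule size_mean_cong)
    fix n x assume n: "n \<in> size_vectors ?K" and x: "x \<in> space (data_measure n)"
    note t = t_nonneg[OF \<psi> n x] and u = stopping_ruleD(2,3)[OF \<psi> n K x]
    have "ennreal (t \<psi> n x) = ennreal (s \<psi> n x) + ennreal (t \<psi> n x * (1 - \<psi> n x))"
      using t u by (simp add: s_def flip: ennreal_plus) (simp add: algebra_simps)
    then show "ennreal (t \<psi> n x) * h (take (Suc k) n) = ennreal (s \<psi> n x) * h (take (Suc k) n) +
      ennreal (t \<psi> n x * (1 - \<psi> n x)) * h (take (Suc k) n)"
      by (simp add: distrib_right)
  qed
  also have "\<dots> = size_mean ?K (\<lambda>n x. ennreal (s \<psi> n x) * h (take (Suc k) n)) +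
      size_mean ?K (\<lambda>n x. ennreal (t \<psi> n x * (1 - \<psi> n x)) * h (take (Suc k) n))"
    using measurable_stopping[OF \<psi> _ K] by (intro size_mean_add) auto
  also have "size_mean ?K (\<lambda>n x. ennreal (t \<psi> n x * (1 - \<psi> n x)) * h (take (Suc k) n)) =
      size_mean (Suc ?K) (\<lambda>n x. ennreal (t \<psi> n x) * h (take (Suc k) n))"
    using size_mean_Suc_t_take[OF \<psi> K, of "\<lambda>n. h (take (Suc k) n)"] by (simp add: min_def)
  finally show ?case
    using Suc.IH by (simp add: add.assoc)
qed

text \<open>With weight 1, conservation of mass makes the probability of still running 1 minus a
  partial sum of the stopping probabilities, which add up to 1 on \<open>F0\<close>.\<close>

lemma size_mean_t_tendsto_0:
  assumes "\<psi> \<in> F0"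
  shows "(\<lambda>K. size_mean (Suc K) (\<lambda>n x. ennreal (t \<psi> n x))) \<longlonglongrightarrow> 0"
proof -
  have \<psi>: "stopping_rule \<psi>" and sum: "(\<Sum>j. size_mean (Suc j) (\<lambda>n x. ennreal (s \<psi> n x))) = 1"
    using assms by (auto simp: F0_def size_mean_def)
  let ?S = "\<lambda>K. \<Sum>j<K. size_mean (Suc j) (\<lambda>n x. ennreal (s \<psi> n x))"
  have "size_mean (Suc 0) (\<lambda>n x. ennreal (t \<psi> n x)) = size_mean (Suc 0) (\<lambda>_ _. 1)"
    by (rule size_mean_cong) (simp add: t_single size_vectors_def)
  also have "\<dots> = 1"
    by (subst size_mean_Suc) (simp_all add: E0_const size_probability size_mean_0)
  finally have "1 = ?S K + size_mean (Suc K) (\<lambda>n x. ennreal (t \<psi> n x))" for K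
    using size_mean_t_take[OF \<psi>, of 0 "\<lambda>_. 1" K] by simp
  then have "size_mean (Suc K) (\<lambda>n x. ennreal (t \<psi> n x)) = 1 - ?S K" for K
    by (metis add.commute ennreal_add_diff_cancel_right ennreal_add_eq_top ennreal_one_neq_top)
  moreover have "(\<lambda>K. 1 - ?S K) \<longlonglongrightarrow> 1 - 1"
    using summable_LIMSEQ[of "\<lambda>j. size_mean (Suc j) (\<lambda>n x. ennreal (s \<psi> n x))"] sum
    by (intro tendsto_diff_ennreal) auto
  ultimately show ?thesis by simp
qed

text \<open>
  For a cost bounded by \<open>b\<close> the runs unfinished at stage \<open>M\<close> contribute at most \<open>b\<close> times their
  probability, which tends to 0.  The cost itself need not be bounded, but it is on a finite set
  of size vectors, and such sets suffice for a sum of nonnegative terms.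
\<close>

lemma tail_cost_le:
  assumes "\<psi> \<in> F0"
  shows "size_mean (Suc k) (\<lambda>n x. ennreal (t \<psi> n x) * ennreal (cost n)) \<le>
    (\<Sum>j. size_mean (Suc (j + k)) (\<lambda>n x. ennreal (s \<psi> n x) * ennreal (cost n)))" (is "_ \<le> ?R")
  unfolding size_mean_def[of "Suc k"]
proof (rule infsum_le_finite_sums)
  have \<psi>: "stopping_rule \<psi>" using assms by (simp add: F0_def)
  fix A assume A: "finite A" "A \<subseteq> size_vectors (Suc k)"
  define b where "b = (\<Sum>n\<in>A. cost n)"
  \<comment> \<open>Setting the weight to 0 off \<open>A\<close> turns the finite sum into a mean
    over all size vectors while keeping the weight below \<open>b\<close>.\<close>
  define h where "h n = (if n \<in> A then ennreal (cost n) else 0)" for n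
  have nonneg: "0 \<le> cost n" if "n \<in> A" for n
    using A that by (intro cost_nonneg) auto
  have h_le: "h n \<le> ennreal b" for n
    using member_le_sum[of n A cost] A nonneg by (auto simp: h_def b_def ennreal_leI)
  have "(\<Sum>n\<in>A. ennreal (size_prob n) * E0 n (\<lambda>x. ennreal (t \<psi> n x) * ennreal (cost n))) =
      (\<Sum>\<^sub>\<infinity>n\<in>A. ennreal (size_prob n) * E0 n (\<lambda>x. ennreal (t \<psi> n x) * h n))"
    using A by (simp add: h_def)
  also have "\<dots> = size_mean (Suc k) (\<lambda>n x. ennreal (t \<psi> n x) * h n)"
    unfolding size_mean_def using A
    by (intro infsum_cong_neutral) (auto simp: h_def E0_const)
  \<comment> \<open>Here \<open>take\<close> is the identity; at later stages it recovers the prefix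
    that determines the weight.\<close>
  also have "\<dots> = size_mean (Suc k) (\<lambda>n x. ennreal (t \<psi> n x) * h (take (Suc k) n))"
    by (rule size_mean_cong) (simp add: size_vectors_def)
  finally have sum_A: "(\<Sum>n\<in>A. ennreal (size_prob n) * E0 n (\<lambda>x. ennreal (t \<psi> n x) * ennreal (cost n))) =
      size_mean (Suc k) (\<lambda>n x. ennreal (t \<psi> n x) * h (take (Suc k) n))" .
  have "size_mean (Suc k) (\<lambda>n x. ennreal (t \<psi> n x) * h (take (Suc k) n)) \<le>
      ?R + ennreal b * size_mean (Suc (M + k)) (\<lambda>n x. ennreal (t \<psi> n x))" for M
    unfolding size_mean_t_take[OF \<psi>, of k h M]
  proof (rule add_mono)
    \<comment> \<open>Costs are positive, so a prefix costs no more than the whole run.\<close>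
    have "h (take (Suc k) n) \<le> ennreal (cost n)" if "n \<in> size_vectors j" for n j
      using cost_take_le[OF that, of "Suc k"] by (auto simp: h_def ennreal_leI)
    then have "(\<Sum>j<M. size_mean (Suc (j + k)) (\<lambda>n x. ennreal (s \<psi> n x) * h (take (Suc k) n))) \<le>
        (\<Sum>j<M. size_mean (Suc (j + k)) (\<lambda>n x. ennreal (s \<psi> n x) * ennreal (cost n)))"
      by (intro sum_mono size_mean_mono mult_left_mono) auto
    also have "\<dots> \<le> ?R" by (rule sum_le_suminf) auto
    finally show "(\<Sum>j<M. size_mean (Suc (j + k)) (\<lambda>n x. ennreal (s \<psi> n x) * h (take (Suc k) n))) \<le> ?R" .
    have "size_mean (Suc (M + k)) (\<lambda>n x. ennreal (t \<psi> n x) * h (take (Suc k) n)) \<le>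
        size_mean (Suc (M + k)) (\<lambda>n x. ennreal b * ennreal (t \<psi> n x))"
      by (subst mult.commute) (intro size_mean_mono mult_right_mono h_le, simp)
    then show "size_mean (Suc (M + k)) (\<lambda>n x. ennreal (t \<psi> n x) * h (take (Suc k) n)) \<le>
        ennreal b * size_mean (Suc (M + k)) (\<lambda>n x. ennreal (t \<psi> n x))"
      using measurable_stopping(1)[OF \<psi>] by (simp add: size_mean_cmult)
  qed
  moreover have "(\<lambda>M. ?R + ennreal b * size_mean (Suc (M + k)) (\<lambda>n x. ennreal (t \<psi> n x)))
      \<longlonglongrightarrow> ?R + ennreal b * 0"
    by (intro tendsto_add tendsto_const ennreal_tendsto_cmult
        LIMSEQ_ignore_initial_segment[OF size_mean_t_tendsto_0[OF assms]]) simp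
  ultimately show "(\<Sum>n\<in>A. ennreal (size_prob n) * E0 n (\<lambda>x. ennreal (t \<psi> n x) * ennreal (cost n))) \<le> ?R"
    unfolding sum_A by (intro LIMSEQ_le_const[where X="\<lambda>M. ?R + ennreal b * size_mean (Suc (M + k)) (\<lambda>n x. ennreal (t \<psi> n x))"]) auto
qed (simp add: nonneg_summable_on_complete)

section \<open>Lower bound for \<open>L\<close> and the case of equality\<close>

lemma L_eq: "L l0 l1 \<psi> = (\<Sum>j. stopped_cost l0 l1 \<psi> (Suc j))"
  by (simp add: L_def stopped_cost_def size_mean_def)

text \<open>The running cost splits into accumulated cost, dominated by the later terms of
  \<open>L\<close>, and remaining value, at most \<open>l0\<close> per unfinished run.\<close>

lemma partial_cost_le:
  assumes "\<psi> \<in> F0"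
  shows "(\<Sum>j<K. stopped_cost l0 l1 \<psi> (Suc j)) + running_cost l0 l1 \<psi> (Suc K) \<le>
    L l0 l1 \<psi> + ennreal l0 * size_mean (Suc K) (\<lambda>n x. ennreal (t \<psi> n x))"
proof -
  have \<psi>: "stopping_rule \<psi>" using assms by (simp add: F0_def)
  have "running_cost l0 l1 \<psi> (Suc K) \<le>
      size_mean (Suc K) (\<lambda>n x. ennreal (t \<psi> n x) * ennreal (cost n) + ennreal l0 * ennreal (t \<psi> n x))"
    unfolding running_cost_def
    by (intro size_mean_mono) (simp add: distrib_left V_lim_le mult.commute[of "ennreal l0"] mult_left_mono)
  also have "\<dots> = size_mean (Suc K) (\<lambda>n x. ennreal (t \<psi> n x) * ennreal (cost n)) +
      ennreal l0 * size_mean (Suc K) (\<lambda>n x. ennreal (t \<psi> n x))"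
    using measurable_stopping(1)[OF \<psi>] by (subst size_mean_add) (auto simp: size_mean_cmult)
  also have "size_mean (Suc K) (\<lambda>n x. ennreal (t \<psi> n x) * ennreal (cost n)) \<le>
      (\<Sum>j. stopped_cost l0 l1 \<psi> (Suc (j + K)))"
    unfolding stopped_cost_def
    by (intro order_trans[OF tail_cost_le[OF assms]] suminf_le size_mean_mono mult_left_mono) auto
  finally have "(\<Sum>j<K. stopped_cost l0 l1 \<psi> (Suc j)) + running_cost l0 l1 \<psi> (Suc K) \<le>
      (\<Sum>j<K. stopped_cost l0 l1 \<psi> (Suc j)) + ((\<Sum>j. stopped_cost l0 l1 \<psi> (Suc (j + K))) +
      ennreal l0 * size_mean (Suc K) (\<lambda>n x. ennreal (t \<psi> n x)))"
    by (intro add_left_mono) (auto intro: order_trans add_right_mono)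
  also have "(\<Sum>j<K. stopped_cost l0 l1 \<psi> (Suc j)) + ((\<Sum>j. stopped_cost l0 l1 \<psi> (Suc (j + K))) +
      ennreal l0 * size_mean (Suc K) (\<lambda>n x. ennreal (t \<psi> n x))) =
      L l0 l1 \<psi> + ennreal l0 * size_mean (Suc K) (\<lambda>n x. ennreal (t \<psi> n x))"
    unfolding L_eq by (subst suminf_offset[where i=K]) (auto simp: add_ac)
  finally show ?thesis .
qed

text \<open>Keeping the gaps makes one estimate serve two ends: \<open>K = 0\<close> gives the lower
  bound, and arbitrary \<open>K\<close> forces the gaps to vanish under equality.\<close>

lemma L_ge:
  assumes "\<psi> \<in> F0"
  shows "mean_cost G p c 1 + V_bar l0 l1 1 1 + (\<Sum>j<K. gap l0 l1 \<psi> (Suc j)) \<le> L l0 l1 \<psi>" (is "?A \<le> _")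
proof (rule LIMSEQ_le_const)
  have \<psi>: "stopping_rule \<psi>" using assms by (simp add: F0_def)
  let ?m = "\<lambda>J. size_mean (Suc J) (\<lambda>n x. ennreal (t \<psi> n x))"
  have "(\<lambda>J. L l0 l1 \<psi> + ennreal l0 * ?m J) \<longlonglongrightarrow> L l0 l1 \<psi> + ennreal l0 * 0"
    by (intro tendsto_add tendsto_const ennreal_tendsto_cmult size_mean_t_tendsto_0[OF assms]) simp
  then show "(\<lambda>J. L l0 l1 \<psi> + ennreal l0 * ?m J) \<longlonglongrightarrow> L l0 l1 \<psi>" by simp
  have "?A \<le> L l0 l1 \<psi> + ennreal l0 * ?m J" if "K \<le> J" for J
  proof -
    \<comment> \<open>Adding nonnegative gaps frees the horizon \<open>J\<close>, which then tends
      to infinity with \<open>K\<close> fixed.\<close>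
    have "?A \<le> mean_cost G p c 1 + V_bar l0 l1 1 1 + (\<Sum>j<J. gap l0 l1 \<psi> (Suc j))"
      using that by (intro add_left_mono sum_mono2) auto
    also have "\<dots> \<le> L l0 l1 \<psi> + ennreal l0 * ?m J"
      using partial_cost_le[OF assms, where K=J] unfolding cost_telescope[OF \<psi>] .
    finally show ?thesis .
  qed
  then show "\<exists>N. \<forall>J\<ge>N. ?A \<le> L l0 l1 \<psi> + ennreal l0 * ?m J" by blast
qed

text \<open>Without gaps the telescoped total is the bound itself; dropping the nonnegative running
  cost leaves the partial sums of \<open>L\<close> below it.\<close>

lemma L_le_if_S_infty:
  assumes "stopping_rule \<psi>" "S_infty l0 l1 \<psi>"
  shows "L l0 l1 \<psi> \<le> mean_cost G p c 1 + V_bar l0 l1 1 1"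
  unfolding L_eq
proof (rule suminf_le_const)
  fix K
  have "(\<Sum>j<K. stopped_cost l0 l1 \<psi> (Suc j)) \<le>
      (\<Sum>j<K. stopped_cost l0 l1 \<psi> (Suc j)) + running_cost l0 l1 \<psi> (Suc K)" by simp
  also have "\<dots> = mean_cost G p c 1 + V_bar l0 l1 1 1"
    using assms unfolding cost_telescope[OF assms(1)] by (simp add: S_infty_iff_gap)
  finally show "(\<Sum>j<K. stopped_cost l0 l1 \<psi> (Suc j)) \<le> mean_cost G p c 1 + V_bar l0 l1 1 1" .
qed simp

lemma S_infty_if_L_eq:
  assumes "\<psi> \<in> F0" and eq: "L l0 l1 \<psi> = mean_cost G p c 1 + V_bar l0 l1 1 1"
  shows "S_infty l0 l1 \<psi>"
proof -
  let ?A = "mean_cost G p c 1 + V_bar l0 l1 1 1"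
  have \<psi>: "stopping_rule \<psi>" using assms by (simp add: F0_def)
  have "?A < top"
    using mean_cost_finite[of 1] le_less_trans[OF V_bar_le[of 1 l0 l1 1], of top] by simp
  moreover have "?A + (\<Sum>j<K. gap l0 l1 \<psi> (Suc j)) \<le> ?A + 0" for K
    using L_ge[OF assms(1), of l0 l1 K] eq by simp
  ultimately have sum: "(\<Sum>j<K. gap l0 l1 \<psi> (Suc j)) = 0" for K
    \<comment> \<open>Cancelling \<open>?A\<close> on both sides relies on its finiteness.\<close>
    unfolding ennreal_add_left_cancel_le by (metis infinity_ennreal_def le_zero_eq less_irrefl)
  have "gap l0 l1 \<psi> (Suc j) = 0" for j
    using sum[of "Suc j"] by simp
  then have "gap l0 l1 \<psi> k = 0" if "1 \<le> k" for k
    using that by (cases k) auto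
  then show ?thesis using \<psi> by (simp add: S_infty_iff_gap)
qed

end

theorem theorem4p2:
  fixes \<mu> :: "'a measure"
    and f0 f1 :: "'a \<Rightarrow> real"
    and G :: "nat set"
    and p :: "nat \<Rightarrow> nat pmf"
    and c :: "nat \<Rightarrow> real"
    and l0 l1 :: real
  assumes setting: "grouped_observations \<mu> f0 f1 G p c"
    and l0: "0 < l0" and l1: "0 < l1"
  defines "F0 \<equiv> grouped_observations.F0 \<mu> f0 G p"
    and "L \<equiv> grouped_observations.L \<mu> f0 f1 G p c l0 l1"
    and "S_infty \<equiv> grouped_observations.S_infty \<mu> f0 f1 G p c l0 l1"
    and "bound \<equiv> mean_cost G p c 1
                 + grouped_observations.V_bar \<mu> f0 f1 G p c l0 l1 1 1"
  shows "(\<forall>\<psi>\<in>F0. bound \<le> L \<psi>) \<and>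
         (\<forall>\<psi>\<in>F0. S_infty \<psi> \<longrightarrow> L \<psi> = bound) \<and>
         (\<forall>\<psi>\<in>F0. L \<psi> = bound \<longrightarrow> S_infty \<psi>)"
proof -
  note defs = F0_def L_def S_infty_def bound_def
  interpret grouped_observations \<mu> f0 f1 G p c by (rule setting)
  have rule: "stopping_rule \<psi>" if "\<psi> \<in> F0" for \<psi>
    using that unfolding defs F0_def by simp
  have ge: "bound \<le> L \<psi>" if "\<psi> \<in> F0" for \<psi>
    using L_ge[of \<psi> l0 l1 0] that unfolding defs by simp
  moreover have "L \<psi> \<le> bound" if "\<psi> \<in> F0" "S_infty \<psi>" for \<psi>
    using L_le_if_S_infty[OF rule[OF that(1)], of l0 l1] that(2) unfolding defs by simp
  moreover have "S_infty \<psi>" if "\<psi> \<in> F0" "L \<psi> = bound" for \<psi>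
    using S_infty_if_L_eq[of \<psi> l0 l1] that unfolding defs by simp
  ultimately show ?thesis by (auto intro!: antisym)
qed

end
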